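(* Let $k\ge 1$ be an integer and let $G$ be a finite simple graph of order $n$ with $n\ge 2k+2$. If $e(G)\ge 2k\left(n-k-\frac12\right)$, then $G$ contains $k$ cycles of consecutive even lengths, i.e., cycles of lengths $2m,2m+2,\dots,2m+2k-2$ for some integer $m\ge 2$.
   Context: $e(G)$ denotes the number of edges of $G$. *)

theory Defs
  imports Complex_Main
begin

definition simple_graph :: "'a set \<Rightarrow> ('a \<Rightarrow> 'a \<Rightarrow> bool) \<Rightarrow> bool" where
  "simple_graph V E \<longleftrightarrow> finite V \<and> (\<forall>x y. E x y \<longrightarrow> x \<in> V \<and> y \<in> V)
     \<and> (\<forall>x y. E x y \<longrightarrow> E y x) \<and> (\<forall>x. \<not> E x x)"

definition edges :: "'a set \<Rightarrow> ('a \<Rightarrow> 'a \<Rightarrow> bool) \<Rightarrow> 'a set set" where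
  "edges V E = {{x, y} | x y. x \<in> V \<and> y \<in> V \<and> E x y}"

definition num_edges :: "'a set \<Rightarrow> ('a \<Rightarrow> 'a \<Rightarrow> bool) \<Rightarrow> nat" where
  "num_edges V E = card (edges V E)"

definition has_cycle_of_length :: "'a set \<Rightarrow> ('a \<Rightarrow> 'a \<Rightarrow> bool) \<Rightarrow> nat \<Rightarrow> bool" where
  "has_cycle_of_length V E L \<longleftrightarrow> L \<ge> 3 \<and> (\<exists>xs. length xs = L \<and> distinct xs \<and> set xs \<subseteq> V
     \<and> (\<forall>i<L. E (xs ! i) (xs ! ((i + 1) mod L))))"

end

(*
  G has a bipartite subgraph with more than k(n - k) edges: k + 1 disjoint edges can be chosen
  greedily, and a cut that separates the ends of each of them has at least (e(G) + k + 1) / 2 edges.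
  Removing vertices of degree at most k leaves a bipartite subgraph of minimum degree at least k + 1.
  Close an edge xy of an end block of it by the paths given by the following fact: if a bipartite
  graph plus the edge xy is 2-connected and all vertices other than x and y have degree at least
  k + 1, then there are k paths from x to y whose lengths form an arithmetic progression with
  difference 2.

  The fact is proved by induction on the number of vertices. A separation by two vertices reduces it
  to one side. For k = 2, a cycle through y all of whose vertices are attached to the part
  containing x has a vertex that is joined to y by two arcs of lengths differing by 2. For k >= 3,
  contract a maximal complete bipartite subgraph at x: the lengths inside it make up for the lost
  degrees. This fails only if a set with exactly three neighbours, one of them x, splits off, and
  then the argument for k = 2 supplies the missing length.
*)
theory Submission
  imports Defs
begin

section \<open>Paths and rooted bipartite graphs\<close>

text \<open>Progressions with \<open>i\<close> and \<open>j\<close> terms concatenate to one with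
  \<open>i + j - 1\<close> terms, so a reduction that lowers the degree bound by \<open>s\<close>
  has to be paid by a piece with \<open>s + 1\<close> lengths; all reductions are balanced against
  this. It is also why \<open>k = 2\<close> stands apart: two pieces with \<open>k - 1\<close>
  lengths each give \<open>2 * k - 3\<close> lengths, which reaches \<open>k\<close> only from
  \<open>k = 3\<close> on. The roots carry no degree condition, since a contracted set may become a
  root of any degree. The constants are tight. The complete bipartite graph with classes of sizes k
  and n - k has k(n - k) edges and only the k - 1 even cycle lengths 4, ..., 2k. The complete graph
  on 2k + 1 vertices attains 2k(n - k - 1/2) and again has only k - 1 even lengths, hence the
  condition n \<ge> 2k + 2. A cut with just half of the edges may be k/2 short of k(n - k), and the
  k + 1 disjoint edges close this gap.\<close>

locale bipartite_graph =
  fixes E :: "'a \<Rightarrow> 'a \<Rightarrow> bool" and col :: "'a \<Rightarrow> bool"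
  assumes sym: "E u v \<Longrightarrow> E v u"
    and bip: "E u v \<Longrightarrow> col u \<noteq> col v"
begin

definition path :: "'a list \<Rightarrow> bool" where
  "path p \<longleftrightarrow> p \<noteq> [] \<and> distinct p \<and> successively E p"

definition reach :: "'a set \<Rightarrow> 'a set \<Rightarrow> 'a set" where
  "reach U A = {v. \<exists>p. path p \<and> set p \<subseteq> U \<and> hd p \<in> A \<and> last p = v}"

definition nb :: "'a set \<Rightarrow> 'a set \<Rightarrow> 'a set" where
  "nb U F = {u \<in> U - F. \<exists>v\<in>F. E v u}"

text \<open>
  A triple of sets \<open>D\<close>, \<open>M\<close>, \<open>L\<close> stands for the graph induced on \<open>D\<close> together with two
  virtual roots \<open>x\<close> and \<open>y\<close> outside \<open>D\<close> whose neighbourhoods are \<open>M\<close> and \<open>L\<close>. Thus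
  \<open>cut D M L F\<close> is the number of neighbours of \<open>F\<close> outside \<open>F\<close> in the rooted graph,
  \<open>cut D M L {v}\<close> is the degree of \<open>v\<close>, and \<open>cut \<ge> 2\<close> on all nonempty subsets of \<open>D\<close> says that the
  rooted graph plus the edge \<open>xy\<close> is 2-connected. Contracting a set of vertices into a root
  only changes \<open>D\<close>, \<open>M\<close> and \<open>L\<close>, never the edge relation.
\<close>

definition cut :: "'a set \<Rightarrow> 'a set \<Rightarrow> 'a set \<Rightarrow> 'a set \<Rightarrow> nat" where
  "cut D M L F = card (nb D F) + of_bool (F \<inter> M \<noteq> {}) + of_bool (F \<inter> L \<noteq> {})"

text \<open>The virtual roots are not listed: \<open>length p\<close> counts the inner vertices of a
  path from x to y, which has \<open>length p + 1\<close> edges.\<close>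

definition fam :: "nat \<Rightarrow> 'a set \<Rightarrow> 'a set \<Rightarrow> 'a set \<Rightarrow> nat \<Rightarrow> bool" where
  "fam a D M L k \<longleftrightarrow> (\<forall>i<k. \<exists>p. path p \<and> set p \<subseteq> D \<and> hd p \<in> M \<and> last p \<in> L \<and> length p = a + 2 * i)"

text \<open>Keeps the graph bipartite when a virtual root with neighbourhood \<open>M\<close> is
  added. Nothing relates the colours of the two roots.\<close>

definition monochromatic :: "'a set \<Rightarrow> bool" where
  "monochromatic M \<longleftrightarrow> (\<forall>u\<in>M. \<forall>v\<in>M. col u = col v)"

definition adm :: "'a set \<Rightarrow> 'a set \<Rightarrow> 'a set \<Rightarrow> nat \<Rightarrow> bool" where
  "adm D M L k \<longleftrightarrow> finite D \<and> D \<noteq> {} \<and> M \<subseteq> D \<and> L \<subseteq> D \<and> monochromatic M \<and> monochromatic L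
     \<and> (\<forall>v\<in>D. k + 1 \<le> cut D M L {v}) \<and> (\<forall>F\<subseteq>D. F \<noteq> {} \<longrightarrow> 2 \<le> cut D M L F)"

section \<open>Paths and reachability\<close>

lemma irrefl: "\<not> E v v"
  using bip by blast

lemma path_nonempty: "path p \<Longrightarrow> p \<noteq> []"
  by (simp add: path_def)

lemma path_Cons: "path (x # p) \<longleftrightarrow> p = [] \<or> x \<notin> set p \<and> E x (hd p) \<and> path p"
  by (auto simp: path_def successively_Cons)

lemma path_append:
  assumes "p \<noteq> []" "q \<noteq> []"
  shows "path (p @ q) \<longleftrightarrow> path p \<and> path q \<and> set p \<inter> set q = {} \<and> E (last p) (hd q)"
  using assms by (auto simp: path_def successively_append_iff)

lemma path_appendD1: "path (p @ q) \<Longrightarrow> p \<noteq> [] \<Longrightarrow> path p"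
  by (auto simp: path_def successively_append_iff)

lemma path_appendD2: "path (p @ q) \<Longrightarrow> q \<noteq> [] \<Longrightarrow> path q"
  by (auto simp: path_def successively_append_iff)

lemma path_rev: "path (rev p) \<longleftrightarrow> path p"
proof -
  have "(\<lambda>x y. E y x) = E"
    using sym by blast
  then have "successively (\<lambda>x y. E y x) p = successively E p"
    by (rule arg_cong)
  then show ?thesis
    by (simp add: path_def successively_rev)
qed

lemma path_sing: "path [v]"
  by (simp add: path_def)

lemma closed_path:
  assumes "successively E p" "p \<noteq> []" "hd p \<in> K" "set p \<subseteq> U"
    and "\<And>u w. u \<in> K \<Longrightarrow> E u w \<Longrightarrow> w \<in> U \<Longrightarrow> w \<in> K"
  shows "set p \<subseteq> K"
  using assms(1-4)
proof (induction p)
  case (Cons x p)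
  then show ?case
    using assms(5) by (cases p) (auto simp: successively_Cons)
qed simp

lemma reach_subset: "reach U A \<subseteq> U"
  unfolding reach_def path_def by auto

lemma reach_base: "v \<in> A \<Longrightarrow> v \<in> U \<Longrightarrow> v \<in> reach U A"
  unfolding reach_def using path_sing[of v] by (auto intro!: exI[of _ "[v]"])

lemma reach_closed:
  assumes "u \<in> reach U A" "E u w" "w \<in> U"
  shows "w \<in> reach U A"
proof -
  obtain p where p: "path p" "set p \<subseteq> U" "hd p \<in> A" "last p = u"
    using assms(1) unfolding reach_def by auto
  show ?thesis
  proof (cases "w \<in> set p")
    case True
    then obtain p1 p2 where pp: "p = p1 @ w # p2"
      by (meson split_list)
    then have "path (p1 @ [w])"
      using p(1) path_appendD1[of "p1 @ [w]" p2] by simp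
    moreover have "hd (p1 @ [w]) \<in> A"
      using p(3) pp by (cases p1) auto
    ultimately show ?thesis
      unfolding reach_def using p(2) pp by (intro CollectI exI[of _ "p1 @ [w]"]) auto
  next
    case False
    then have "path (p @ [w])"
      using p path_nonempty[OF p(1)] assms(2) by (subst path_append) (auto simp: path_sing)
    then show ?thesis
      unfolding reach_def using p path_nonempty[OF p(1)] assms(3) by (intro CollectI exI[of _ "p @ [w]"]) auto
  qed
qed

lemma reach_path:
  assumes "path p" "hd p \<in> reach U A" "set p \<subseteq> U"
  shows "set p \<subseteq> reach U A"
  using closed_path[of p "reach U A" U] assms reach_closed[of _ U A] unfolding path_def by blast

lemma reachE:
  assumes "v \<in> reach U A"
  obtains p where "path p" "set p \<subseteq> reach U A" "hd p \<in> A" "last p = v"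
proof -
  obtain p where p: "path p" "set p \<subseteq> U" "hd p \<in> A" "last p = v"
    using assms unfolding reach_def by auto
  have "hd p \<in> U"
    using p path_nonempty by auto
  then have "set p \<subseteq> reach U A"
    using p reach_path reach_base by blast
  with p that show ?thesis by blast
qed

lemma reach_nb: "nb U (reach U A) = {}"
  unfolding nb_def using reach_closed by blast

text \<open>Joining \<open>rev p\<close> and \<open>q\<close> at \<open>x\<close> may repeat
  vertices. The closure of \<open>reach\<close> replaces this walk by a path: \<open>x\<close> is
  reachable from \<open>u\<close> inside the component, and then so is \<open>w\<close>.\<close>

lemma reach_connected:
  assumes "u \<in> reach U {x}" "w \<in> reach U {x}"
  obtains p where "path p" "set p \<subseteq> reach U {x}" "hd p = u" "last p = w"
proof -
  let ?K = "reach U {x}"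
  obtain p where p: "path p" "set p \<subseteq> ?K" "hd p = x" "last p = u"
    using reachE[OF assms(1)] by blast
  obtain q where q: "path q" "set q \<subseteq> ?K" "hd q = x" "last q = w"
    using reachE[OF assms(2)] by blast
  have "set (rev p) \<subseteq> reach ?K {u}"
    using p path_nonempty[OF p(1)] assms(1)
    by (intro reach_path[of "rev p" ?K "{u}"]) (auto simp: path_rev hd_rev intro: reach_base)
  then have "x \<in> reach ?K {u}"
    using p(3) path_nonempty[OF p(1)] by auto
  then have "set q \<subseteq> reach ?K {u}"
    using q by (intro reach_path[of q ?K "{u}"]) auto
  then have "w \<in> reach ?K {u}"
    using q(4) path_nonempty[OF q(1)] by auto
  then show ?thesis
    using reachE[of w ?K "{u}"] reach_subset[of ?K "{u}"] that
    by (metis singletonD subset_trans)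
qed

text \<open>\<open>S\<close> stands for the attachments of a component to the path \<open>P\<close>;
  \<open>a\<close> and \<open>b\<close> tell whether the component is also attached to the root
  before or behind \<open>P\<close>. Two attachments suffice to find two consecutive ones. An empty
  \<open>P1\<close> or \<open>P3\<close> means that a root is one of them.\<close>

lemma split_between:
  assumes "S \<subseteq> set P" "2 \<le> card S + of_bool a + (of_bool b :: nat)"
  shows "\<exists>P1 Pm P3. P = P1 @ Pm @ P3 \<and> set Pm \<inter> S = {} \<and>
    (if P1 = [] then a else last P1 \<in> S) \<and> (if P3 = [] then b else hd P3 \<in> S)"
    (is ?goal)
proof -
  have split2: ?goal if "P = P1 @ R" "if P1 = [] then a else last P1 \<in> S"
    "set R \<inter> S \<noteq> {} \<or> b" for P1 R
  proof (cases "set R \<inter> S = {}")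
    case True
    then show ?thesis
      using that by (intro exI[of _ P1] exI[of _ R] exI[of _ "[]"]) auto
  next
    case False
    then obtain Pm w P3 where "R = Pm @ w # P3" "w \<in> S" "\<forall>y\<in>set Pm. y \<notin> S"
      using split_list_first_prop[of R "\<lambda>x. x \<in> S"] by blast
    then show ?thesis
      using that by (intro exI[of _ P1] exI[of _ Pm] exI[of _ "w # P3"]) auto
  qed
  have fin: "finite S"
    using assms(1) finite_subset by blast
  show ?thesis
  proof (cases a)
    case True
    have "set P \<inter> S \<noteq> {} \<or> b"
      using assms fin True by (cases b) (auto simp: Int_absorb1)
    then show ?thesis
      using split2[of "[]" P] True by auto
  next
    case False
    then have "S \<noteq> {}"
      using assms by (cases b) auto
    then obtain ys z zs where P: "P = ys @ z # zs" "z \<in> S" "\<forall>y\<in>set ys. y \<notin> S"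
      using split_list_first_prop[of P "\<lambda>x. x \<in> S"] assms(1) by blast
    have "set zs \<inter> S \<noteq> {} \<or> b"
    proof (rule ccontr)
      assume "\<not> (set zs \<inter> S \<noteq> {} \<or> b)"
      then have "S \<subseteq> {z}" "\<not> b"
        using P assms(1) by auto
      then show False
        using assms(2) False card_mono[of "{z}" S] by auto
    qed
    then show ?thesis
      using split2[of "ys @ [z]" zs] P by auto
  qed
qed

text \<open>
  Take a path whose complement has the smallest possible component \<open>K\<close> around \<open>v0\<close>, and reroute
  it through \<open>K\<close> between two consecutive attachments: the released vertices are not attached
  to \<open>K\<close>, so the component shrinks.
\<close>

lemma on_path:
  assumes fin: "finite D" and sub: "M \<subseteq> D" "L \<subseteq> D"
    and cut2: "\<And>F. F \<subseteq> D \<Longrightarrow> F \<noteq> {} \<Longrightarrow> 2 \<le> cut D M L F" and v0: "v0 \<in> D"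
  obtains p where "path p" "set p \<subseteq> D" "hd p \<in> M" "last p \<in> L" "v0 \<in> set p"
proof -
  define conn where "conn p \<longleftrightarrow> path p \<and> set p \<subseteq> D \<and> hd p \<in> M \<and> last p \<in> L" for p
  define m where "m p = card (reach (D - set p) {v0})" for p
  have "D \<noteq> {}" "nb D D = {}"
    using v0 by (auto simp: nb_def)
  then have "M \<noteq> {}"
    using cut2[of D] unfolding cut_def by (auto simp: of_bool_def split: if_splits)
  then obtain mm where mm: "mm \<in> M" by blast
  then have "reach D M \<noteq> {}"
    using reach_base sub by blast
  \<comment> \<open>A union of components has no neighbours in \<open>D\<close>, so its cut of at
    least 2 must come from both roots. This gives a first path to start the minimization.\<close>
  then have "reach D M \<inter> L \<noteq> {}"
    using cut2[of "reach D M"] reach_subset[of D M] reach_nb[of D M] unfolding cut_def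
    by (auto simp: of_bool_def split: if_splits)
  then obtain l where "l \<in> reach D M" "l \<in> L" by blast
  then obtain p0 where "conn p0"
    using reachE[of l D M] reach_subset[of D M] unfolding conn_def by (metis subset_trans)
  then obtain P where P: "conn P" "\<And>p. conn p \<Longrightarrow> m P \<le> m p"
    using ex_has_least_nat[of conn p0 m] by blast
  have "\<exists>p. conn p \<and> v0 \<in> set p"
  proof (rule ccontr)
    assume no: "\<not> ?thesis"
    define K where "K = reach (D - set P) {v0}"
    have v0K: "v0 \<in> K"
      unfolding K_def using no P v0 by (intro reach_base) auto
    have KD: "K \<subseteq> D - set P"
      unfolding K_def by (rule reach_subset)
    have nbK: "nb D K \<subseteq> set P"
      unfolding nb_def K_def using reach_closed[of _ "D - set P" "{v0}"] by blast
    have "2 \<le> card (nb D K) + of_bool (K \<inter> M \<noteq> {}) + of_bool (K \<inter> L \<noteq> {})"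
      using cut2[of K] KD v0K unfolding cut_def by blast
    then obtain P1 Pm P3 where sp: "P = P1 @ Pm @ P3" "set Pm \<inter> nb D K = {}"
      "if P1 = [] then K \<inter> M \<noteq> {} else last P1 \<in> nb D K"
      "if P3 = [] then K \<inter> L \<noteq> {} else hd P3 \<in> nb D K"
      using split_between[OF nbK, of "K \<inter> M \<noteq> {}" "K \<inter> L \<noteq> {}"] by blast
    have Pp: "path P" "set P \<subseteq> D" "hd P \<in> M" "last P \<in> L"
      using P unfolding conn_def by auto
    obtain u where u: "u \<in> K" "if P1 = [] then u \<in> M else E (last P1) u"
      using sp(3) sym unfolding nb_def by (cases "P1 = []") auto
    obtain w where w: "w \<in> K" "if P3 = [] then w \<in> L else E w (hd P3)"
      using sp(4) unfolding nb_def by (cases "P3 = []") auto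
    obtain q where q: "path q" "set q \<subseteq> K" "hd q = u" "last q = w"
      using reach_connected u(1) w(1) unfolding K_def by metis
    have qn: "q \<noteq> []"
      using q path_nonempty by auto
    have dis: "set q \<inter> set P = {}"
      using q KD by auto
    have A: "path (q @ P3)" "hd (q @ P3) = u" "last (q @ P3) \<in> L"
    proof -
      show "path (q @ P3)"
      proof (cases "P3 = []")
        case False
        then have "path P3"
          using Pp(1) sp(1) path_appendD2[of "P1 @ Pm" P3] by simp
        then show ?thesis
          using False q w(2) qn dis sp(1) by (subst path_append) auto
      qed (use q in auto)
      show "hd (q @ P3) = u"
        using q qn by simp
      show "last (q @ P3) \<in> L"
        using q w Pp(4) sp(1) by (cases "P3 = []") auto
    qed
    have "conn (P1 @ q @ P3)"
    proof (cases "P1 = []")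
      case True
      then show ?thesis
        unfolding conn_def using A u(2) q(2) KD Pp(2) sp(1) by auto
    next
      case False
      then have "path P1"
        using Pp(1) sp(1) path_appendD1[of P1 "Pm @ P3"] by simp
      moreover have "set P1 \<inter> set (q @ P3) = {}"
        using Pp(1) sp(1) dis unfolding path_def by auto
      ultimately have "path (P1 @ q @ P3)"
        using False A u(2) qn by (subst path_append) auto
      then show ?thesis
        unfolding conn_def using A qn q(2) KD Pp(2,3) sp(1) False by auto
    qed
    note conn' = this
    let ?P' = "P1 @ q @ P3"
    have "reach (D - set ?P') {v0} \<subseteq> K - set q"
    proof
      fix z assume "z \<in> reach (D - set ?P') {v0}"
      then obtain p where p: "path p" "set p \<subseteq> D - set ?P'" "hd p = v0" "last p = z"
        unfolding reach_def by auto
      have "set p \<subseteq> K"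
      proof (rule closed_path[of p K "D - set ?P'"])
        fix a b assume ab: "a \<in> K" "E a b" "b \<in> D - set ?P'"
        then show "b \<in> K"
          using nbK sp unfolding nb_def by auto
      qed (use p v0K path_def in auto)
      then show "z \<in> K - set q"
        using p path_nonempty[OF p(1)] last_in_set[of p] by auto
    qed
    moreover have "u \<in> K \<inter> set q"
      using u q qn hd_in_set by force
    ultimately have "m ?P' < m P"
      unfolding m_def K_def[symmetric]
      by (intro psubset_card_mono finite_subset[OF KD]) (use fin in auto)
    then show False
      using P(2)[OF conn'] by simp
  qed
  then show ?thesis
    using that unfolding conn_def by blast
qed

section \<open>Accounting for cuts and for progressions of path lengths\<close>

lemma finite_nb: "finite U \<Longrightarrow> finite (nb U F)"
  unfolding nb_def by auto

text \<open>The accounting used whenever part of a rooted graph becomes a rooted graph of its own: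
  the neighbours \<open>X\<close> lost outside \<open>G\<close> and the old roots are paid for by
  the new roots, up to a deficit \<open>c\<close> that becomes the drop of the degree bound.\<close>

lemma cut_compare:
  assumes "finite G" "finite X" "nb D F \<subseteq> nb G F \<union> X"
    and "card X + of_bool (F \<inter> M \<noteq> {}) + of_bool (F \<inter> L \<noteq> {})
      \<le> of_bool (F \<inter> M' \<noteq> {}) + of_bool (F \<inter> L' \<noteq> {}) + c"
  shows "cut D M L F \<le> cut G M' L' F + c"
proof -
  have "card (nb D F) \<le> card (nb G F \<union> X)"
    using assms(1-3) finite_nb by (intro card_mono) auto
  also have "\<dots> \<le> card (nb G F) + card X"
    by (rule card_Un_le)
  finally show ?thesis
    using assms(4) unfolding cut_def by linarith
qed

lemma monochromatic_subset: "monochromatic M \<Longrightarrow> N \<subseteq> M \<Longrightarrow> monochromatic N"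
  unfolding monochromatic_def by blast

lemma monochromatic_Int: "monochromatic M \<Longrightarrow> monochromatic (N \<inter> M)"
  unfolding monochromatic_def by blast

lemma monochromatic_nbrs: "monochromatic {u. E x u}" "monochromatic {u. E u x}"
  using bip unfolding monochromatic_def by blast+

lemma path_subst:
  assumes "path (P1 @ Pm @ P3)" "path q" "set q \<inter> (set P1 \<union> set P3) = {}"
    and "P1 \<noteq> [] \<Longrightarrow> E (last P1) (hd q)" "P3 \<noteq> [] \<Longrightarrow> E (last q) (hd P3)"
  shows "path (P1 @ q @ P3)"
proof -
  have "q \<noteq> []"
    using assms(2) path_nonempty by auto
  then show ?thesis
    using assms by (auto simp: path_def successively_append_iff)
qed

lemma path_parity: "path p \<Longrightarrow> odd (length p) \<longleftrightarrow> col (hd p) = col (last p)"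
proof (induction p)
  case (Cons x p)
  then show ?case
    using bip[of x "hd p"] by (cases "p = []") (auto simp: path_Cons)
qed (simp add: path_def)

lemma fam_mono:
  assumes "fam a D M L k" "k' \<le> k" "D \<subseteq> D'" "M \<subseteq> M'" "L \<subseteq> L'"
  shows "fam a D' M' L' k'"
  unfolding fam_def
proof (intro allI impI)
  fix i assume "i < k'"
  then obtain p where "path p" "set p \<subseteq> D" "hd p \<in> M" "last p \<in> L" "length p = a + 2 * i"
    using assms(1,2) unfolding fam_def by (meson less_le_trans)
  then show "\<exists>p. path p \<and> set p \<subseteq> D' \<and> hd p \<in> M' \<and> last p \<in> L' \<and> length p = a + 2 * i"
    using assms(3-5) by blast
qed

lemma fam_rev:
  assumes "fam a D M L k"
  shows "fam a D L M k"
  unfolding fam_def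
proof (intro allI impI)
  fix i assume "i < k"
  then obtain p where p: "path p" "set p \<subseteq> D" "hd p \<in> M" "last p \<in> L" "length p = a + 2 * i"
    using assms unfolding fam_def by blast
  show "\<exists>p. path p \<and> set p \<subseteq> D \<and> hd p \<in> L \<and> last p \<in> M \<and> length p = a + 2 * i"
    using p path_nonempty[OF p(1)] by (intro exI[of _ "rev p"]) (auto simp: path_rev hd_rev last_rev)
qed

lemma fam_path: "path p \<Longrightarrow> fam (length p) (set p) {hd p} {last p} 1"
  unfolding fam_def by auto

text \<open>Two progressions of step 2 with \<open>k1\<close> and \<open>k2\<close> terms have a sumset with \<open>k1 + k2 - 1\<close> terms.\<close>

lemma fam_concat:
  assumes A: "\<And>m. m \<in> M2 \<Longrightarrow> fam a D1 M1 {l. E l m} k1" and B: "fam b D2 M2 L2 k2"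
    and dis: "D1 \<inter> D2 = {}" and k: "1 \<le> k1" "1 \<le> k2" "k + 1 \<le> k1 + k2"
  shows "fam (a + b) (D1 \<union> D2) M1 L2 k"
  unfolding fam_def
proof (intro allI impI)
  fix i assume i: "i < k"
  define i2 where "i2 = min i (k2 - 1)"
  have i2: "i2 < k2" "i - i2 < k1" "i2 \<le> i"
    using k i unfolding i2_def by auto
  obtain q where q: "path q" "set q \<subseteq> D2" "hd q \<in> M2" "last q \<in> L2" "length q = b + 2 * i2"
    using B i2(1) unfolding fam_def by blast
  obtain p where p: "path p" "set p \<subseteq> D1" "hd p \<in> M1" "E (last p) (hd q)" "length p = a + 2 * (i - i2)"
    using A[OF q(3)] i2(2) unfolding fam_def by blast
  have ne: "p \<noteq> []" "q \<noteq> []"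
    using p q path_nonempty by auto
  then have "path (p @ q)"
    using p q dis by (subst path_append) auto
  then show "\<exists>p. path p \<and> set p \<subseteq> D1 \<union> D2 \<and> hd p \<in> M1 \<and> last p \<in> L2 \<and> length p = a + b + 2 * i"
    using p q ne i2 by (intro exI[of _ "p @ q"]) auto
qed

text \<open>A zigzag with \<open>j\<close> vertices of \<open>S\<close> and \<open>j + 1\<close>
  vertices of \<open>T\<close>, which grows by two vertices at its end.\<close>

lemma biclique_path:
  assumes "finite S" "finite T" "\<And>u t. u \<in> S \<Longrightarrow> t \<in> T \<Longrightarrow> E u t"
    and "j \<le> card S" "j < card T" "t \<in> T"
  shows "\<exists>p. path p \<and> set p \<subseteq> S \<union> T \<and> hd p \<in> T \<and> last p = t \<and> length p = 2 * j + 1"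
  using assms
proof (induction j arbitrary: S T t)
  case 0
  then show ?case
    by (intro exI[of _ "[t]"]) (auto simp: path_sing)
next
  case (Suc j)
  obtain u where u: "u \<in> S"
    using Suc.prems(4) by fastforce
  have "card (T - {t}) \<ge> Suc j"
    using Suc.prems by simp
  then obtain t' where t': "t' \<in> T - {t}"
    by (metis card.empty ex_in_conv not_less_eq_eq zero_le)
  have "\<exists>p. path p \<and> set p \<subseteq> (S - {u}) \<union> (T - {t}) \<and> hd p \<in> T - {t} \<and> last p = t' \<and> length p = 2 * j + 1"
    using Suc.prems u t' by (intro Suc.IH) auto
  then obtain p where p: "path p" "set p \<subseteq> (S - {u}) \<union> (T - {t})" "hd p \<in> T - {t}" "last p = t'"
    "length p = 2 * j + 1"
    by blast
  have disj: "t \<notin> S" "u \<notin> T"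
    using Suc.prems(3,6) u irrefl by blast+
  have "path (p @ [u, t])"
    using p path_nonempty[OF p(1)] u t' Suc.prems(3,6) disj irrefl sym
    by (subst path_append) (auto simp: path_Cons)
  then show ?case
    using p path_nonempty[OF p(1)] u Suc.prems(6) by (intro exI[of _ "p @ [u, t]"]) auto
qed

lemma biclique_fam:
  assumes "finite S" "finite T" "\<And>u t. u \<in> S \<Longrightarrow> t \<in> T \<Longrightarrow> E u t" "card S < card T" "t \<in> T"
  shows "fam 1 (S \<union> T) T {t} (card S + 1)"
  unfolding fam_def
proof (intro allI impI)
  fix i assume "i < card S + 1"
  then show "\<exists>p. path p \<and> set p \<subseteq> S \<union> T \<and> hd p \<in> T \<and> last p \<in> {t} \<and> length p = 1 + 2 * i"
    using biclique_path[of S T i t] assms by auto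
qed

text \<open>Here \<open>s\<close> is reserved as the last vertex, which leaves one length fewer than
  for an end in \<open>T\<close>.\<close>

lemma biclique_fam':
  assumes "finite S" "finite T" "\<And>u t. u \<in> S \<Longrightarrow> t \<in> T \<Longrightarrow> E u t" "card S < card T" "s \<in> S"
  shows "fam 2 (S \<union> T) T {s} (card S)"
  unfolding fam_def
proof (intro allI impI)
  fix i assume i: "i < card S"
  obtain t where t: "t \<in> T"
    using assms(4) by fastforce
  have "i \<le> card (S - {s})" "i < card T"
    using assms(1,4,5) i by auto
  then obtain p where p: "path p" "set p \<subseteq> (S - {s}) \<union> T" "hd p \<in> T" "last p = t" "length p = 2 * i + 1"
    using biclique_path[of "S - {s}" T i t] assms(1-3) t by auto
  have "s \<notin> T"
    using assms(3,5) irrefl by blast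
  then have "path (p @ [s])"
    using p path_nonempty[OF p(1)] t assms(3,5) sym by (subst path_append) (auto simp: path_sing)
  then show "\<exists>p. path p \<and> set p \<subseteq> S \<union> T \<and> hd p \<in> T \<and> last p \<in> {s} \<and> length p = 2 + 2 * i"
    using p path_nonempty[OF p(1)] assms(5) by (intro exI[of _ "p @ [s]"]) auto
qed

text \<open>A path through \<open>F\<close> enters it first at \<open>x\<close> and leaves it last
  at \<open>z\<close>. The vertices just outside, or the roots in their place, use up the whole cut
  of size 2. As virtual roots of \<open>F\<close> they preserve all cuts inside \<open>F\<close>,
  and \<open>P1\<close> and \<open>P3\<close> prolong the paths found there by a fixed
  amount.\<close>

lemma reduce_two_cut:
  assumes adm: "adm D M L k"
    and IH: "\<And>D' M' L'. adm D' M' L' k \<Longrightarrow> card D' < card D \<Longrightarrow> \<exists>a. fam a D' M' L' k"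
    and F: "F \<subseteq> D" "F \<noteq> {}" "F \<noteq> D" "cut D M L F \<le> 2"
  shows "\<exists>a. fam a D M L k"
proof -
  have D: "finite D" "M \<subseteq> D" "L \<subseteq> D" "monochromatic M" "monochromatic L"
    and cutk: "\<And>v. v \<in> D \<Longrightarrow> k + 1 \<le> cut D M L {v}"
    and cut2: "\<And>F. F \<subseteq> D \<Longrightarrow> F \<noteq> {} \<Longrightarrow> 2 \<le> cut D M L F"
    using adm unfolding adm_def by auto
  obtain v0 where v0: "v0 \<in> F"
    using F by blast
  then obtain P where P: "path P" "set P \<subseteq> D" "hd P \<in> M" "last P \<in> L" "v0 \<in> set P"
    using on_path[OF D(1-3) cut2] F(1) by (metis subsetD)
  obtain P1 x Q where P1: "P = P1 @ x # Q" "x \<in> F" "\<forall>y\<in>set P1. y \<notin> F"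
    using split_list_first_prop[of P "\<lambda>x. x \<in> F"] P(5) v0 by blast
  obtain R z P3 where P3: "x # Q = R @ z # P3" "z \<in> F" "\<forall>y\<in>set P3. y \<notin> F"
    using split_list_last_prop[of "x # Q" "\<lambda>x. x \<in> F"] P1(2) by auto
  define Pm where "Pm = R @ [z]"
  have P': "P = P1 @ Pm @ P3" "Pm \<noteq> []" "last Pm = z"
    using P1 P3 unfolding Pm_def by auto
  have hdPm: "hd Pm = x"
    using P3(1) unfolding Pm_def by (cases R) auto
  define M1 where "M1 = (if P1 = [] then F \<inter> M else F \<inter> {u. E (last P1) u})"
  define L1 where "L1 = (if P3 = [] then F \<inter> L else F \<inter> {u. E u (hd P3)})"
  have e1: "if P1 = [] then F \<inter> M \<noteq> {} else last P1 \<in> nb D F"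
  proof (cases "P1 = []")
    case True
    then show ?thesis using P(3) P' hdPm P1(2) by auto
  next
    case False
    then have "E (last P1) x"
      using P(1) P1(1) path_append[of P1 "x # Q"] by auto
    then show ?thesis
      using False P1 P(2) sym unfolding nb_def by auto
  qed
  have e3: "if P3 = [] then F \<inter> L \<noteq> {} else hd P3 \<in> nb D F"
  proof (cases "P3 = []")
    case True
    then show ?thesis using P(4) P' P3(2) by auto
  next
    case False
    then have "E z (hd P3)"
      using P(1) P' path_append[of "P1 @ Pm" P3] by auto
    then show ?thesis
      using False P3 P'(1) P(2) unfolding nb_def by auto
  qed
  have finnb: "finite (nb D X)" for X
    using D(1) by (rule finite_nb)
  have "set P1 \<inter> set P3 = {}"
    using P(1) P'(1) unfolding path_def by auto
  then have neq: "P1 \<noteq> [] \<Longrightarrow> P3 \<noteq> [] \<Longrightarrow> last P1 \<noteq> hd P3"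
    by (metis disjoint_iff hd_in_set last_in_set)
  have two: "card (nb D F) + of_bool (F \<inter> M \<noteq> {}) + of_bool (F \<inter> L \<noteq> {}) \<le> (2::nat)"
    using F(4) unfolding cut_def .
  have sub: "nb D F \<subseteq> (if P1 = [] then {} else {last P1}) \<union> (if P3 = [] then {} else {hd P3})"
    and FM: "P1 \<noteq> [] \<Longrightarrow> F \<inter> M = {}" and FL: "P3 \<noteq> [] \<Longrightarrow> F \<inter> L = {}"
  proof -
    let ?A = "if P1 = [] then {} else {last P1}" and ?B = "if P3 = [] then {} else {hd P3}"
    have AB: "?A \<union> ?B \<subseteq> nb D F"
      using e1 e3 by auto
    have cAB: "card (?A \<union> ?B) = of_bool (P1 \<noteq> []) + of_bool (P3 \<noteq> [])"
      using neq by auto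
    have le: "card (?A \<union> ?B) \<le> card (nb D F)"
      using AB finnb card_mono by blast
    have "card (nb D F) \<le> card (?A \<union> ?B)"
      using e1 e3 two cAB by (auto split: if_splits)
    then show "nb D F \<subseteq> ?A \<union> ?B"
      using card_seteq[OF finnb AB] by blast
    show "P1 \<noteq> [] \<Longrightarrow> F \<inter> M = {}" "P3 \<noteq> [] \<Longrightarrow> F \<inter> L = {}"
      using e1 e3 two cAB le by (auto simp: of_bool_def split: if_splits)
  qed
  have cutF: "cut D M L F' \<le> cut F M1 L1 F'" if F': "F' \<subseteq> F" for F'
  proof -
    define X1 where "X1 = (if P1 \<noteq> [] \<and> F' \<inter> M1 \<noteq> {} then {last P1} else {})"
    define X3 where "X3 = (if P3 \<noteq> [] \<and> F' \<inter> L1 \<noteq> {} then {hd P3} else {})"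
    have "nb D F' \<subseteq> nb F F' \<union> (X1 \<union> X3)"
    proof
      fix z assume z: "z \<in> nb D F'"
      then obtain v where v: "v \<in> F'" "E v z" "z \<in> D - F'"
        unfolding nb_def by auto
      show "z \<in> nb F F' \<union> (X1 \<union> X3)"
      proof (cases "z \<in> F")
        case True
        then show ?thesis using v unfolding nb_def by auto
      next
        case False
        then have "z \<in> nb D F"
          using v F' unfolding nb_def by auto
        then have "P1 \<noteq> [] \<and> z = last P1 \<or> P3 \<noteq> [] \<and> z = hd P3"
          using sub by (auto split: if_splits)
        then show ?thesis
          using v F' sym unfolding X1_def X3_def M1_def L1_def by auto
      qed
    qed
    moreover have "card X1 + of_bool (F' \<inter> M \<noteq> {}) \<le> (of_bool (F' \<inter> M1 \<noteq> {}) :: nat)"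
      using FM F' unfolding X1_def M1_def by (auto simp: of_bool_def)
    moreover have "card X3 + of_bool (F' \<inter> L \<noteq> {}) \<le> (of_bool (F' \<inter> L1 \<noteq> {}) :: nat)"
      using FL F' unfolding X3_def L1_def by (auto simp: of_bool_def)
    moreover have "card (X1 \<union> X3) \<le> card X1 + card X3"
      by (rule card_Un_le)
    moreover have "finite (X1 \<union> X3)" "finite F"
      using D(1) F(1) finite_subset unfolding X1_def X3_def by auto
    ultimately show ?thesis
      using cut_compare[of F "X1 \<union> X3" D F' M L M1 L1 0] by linarith
  qed
  have "adm F M1 L1 k"
    unfolding adm_def
  proof (intro conjI ballI allI impI)
    show "finite F" using D(1) F(1) finite_subset by blast
    show "F \<noteq> {}" "M1 \<subseteq> F" "L1 \<subseteq> F"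
      using F unfolding M1_def L1_def by auto
    show "monochromatic M1"
      unfolding M1_def by (simp add: monochromatic_Int D(4) monochromatic_nbrs)
    show "monochromatic L1"
      unfolding L1_def by (simp add: monochromatic_Int D(5) monochromatic_nbrs)
    show "k + 1 \<le> cut F M1 L1 {v}" if "v \<in> F" for v
      using cutk[of v] cutF[of "{v}"] that F(1) by (auto intro: le_trans)
    show "2 \<le> cut F M1 L1 F'" if "F' \<subseteq> F" "F' \<noteq> {}" for F'
      using cut2[of F'] cutF[of F'] that F(1) by (auto intro: le_trans)
  qed
  moreover have "card F < card D"
    using D(1) F by (meson psubsetI psubset_card_mono)
  ultimately obtain a where a: "fam a F M1 L1 k"
    using IH by blast
  have "fam (length P1 + a + length P3) D M L k"
    unfolding fam_def
  proof (intro allI impI)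
    fix i assume "i < k"
    then obtain p where p: "path p" "set p \<subseteq> F" "hd p \<in> M1" "last p \<in> L1" "length p = a + 2 * i"
      using a unfolding fam_def by blast
    have pn: "p \<noteq> []"
      using p(1) by (rule path_nonempty)
    have "path (P1 @ p @ P3)"
    proof (rule path_subst[of P1 Pm P3])
      show "path (P1 @ Pm @ P3)"
        using P(1) P'(1) by simp
      show "set p \<inter> (set P1 \<union> set P3) = {}"
        using p(2) P1(3) P3(3) by blast
      show "P1 \<noteq> [] \<Longrightarrow> E (last P1) (hd p)" "P3 \<noteq> [] \<Longrightarrow> E (last p) (hd P3)"
        using p(3,4) unfolding M1_def L1_def by simp_all
    qed (rule p(1))
    moreover have "hd (P1 @ p @ P3) \<in> M"
      using p(3) P(3) P'(1) pn unfolding M1_def by (cases "P1 = []") simp_all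
    moreover have "last (P1 @ p @ P3) \<in> L"
      using p(4) P(4) P'(1) pn unfolding L1_def by (cases "P3 = []") simp_all
    ultimately show "\<exists>p. path p \<and> set p \<subseteq> D \<and> hd p \<in> M \<and> last p \<in> L
        \<and> length p = length P1 + a + length P3 + 2 * i"
      using p(2,5) F(1) P(2) P'(1) by (intro exI[of _ "P1 @ p @ P3"]) auto
  qed
  then show ?thesis by blast
qed

subsection \<open>Lollipops\<close>

text \<open>
  The alternative to a lollipop: a set \<open>F\<close> with at most two boundary vertices (one of them may be
  the root \<open>y\<close>, encoded by \<open>w2 = []\<close>), joined to \<open>A\<close> by \<open>w1\<close> and to \<open>y\<close> by \<open>w2\<close>.
  An \<open>ear\<close> is a cycle through \<open>y\<close> with \<open>y\<close> removed.
\<close>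

definition fcase :: "'a set \<Rightarrow> 'a set \<Rightarrow> 'a set \<Rightarrow> bool" where
  "fcase U A L \<longleftrightarrow> (\<exists>F w1 w2. F \<noteq> {} \<and> F \<subseteq> U - A \<and> path w1 \<and> set w1 \<subseteq> U - F \<and> hd w1 \<in> A \<and>
    nb U F \<subseteq> {last w1} \<union> (if w2 = [] then {} else {hd w2}) \<and>
    (w2 \<noteq> [] \<longrightarrow> path w2 \<and> set w2 \<subseteq> U - F \<and> set w1 \<inter> set w2 = {} \<and> last w2 \<in> L \<and> F \<inter> L = {}))"

definition ear :: "'a set \<Rightarrow> 'a set \<Rightarrow> 'a list \<Rightarrow> bool" where
  "ear U L C \<longleftrightarrow> path C \<and> set C \<subseteq> U \<and> hd C \<in> L \<and> last C \<in> L \<and> 2 \<le> length C"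

text \<open>In the application to an ear, an empty \<open>C1\<close> or \<open>C3\<close> means that
  the run reaches an end of the ear and is thus next to the root y.\<close>

lemma split_run:
  assumes "v \<in> set C" "\<not> Q v"
  shows "\<exists>C1 I C3. C = C1 @ I @ C3 \<and> v \<in> set I \<and> (\<forall>z\<in>set I. \<not> Q z)
    \<and> (C1 \<noteq> [] \<longrightarrow> Q (last C1)) \<and> (C3 \<noteq> [] \<longrightarrow> Q (hd C3))"
proof -
  obtain X Y where C: "C = X @ v # Y"
    using assms(1) split_list by metis
  have "\<exists>C1 I1. X = C1 @ I1 \<and> (\<forall>z\<in>set I1. \<not> Q z) \<and> (C1 \<noteq> [] \<longrightarrow> Q (last C1))"
  proof (cases "\<exists>x\<in>set X. Q x")
    case True
    then obtain ys x zs where "X = ys @ x # zs" "Q x" "\<forall>z\<in>set zs. \<not> Q z"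
      using split_list_last_prop[of X Q] by blast
    then show ?thesis
      by (intro exI[of _ "ys @ [x]"] exI[of _ zs]) auto
  next
    case False
    then show ?thesis by (intro exI[of _ "[]"] exI[of _ X]) auto
  qed
  then obtain C1 I1 where 1: "X = C1 @ I1" "\<forall>z\<in>set I1. \<not> Q z" "C1 \<noteq> [] \<longrightarrow> Q (last C1)"
    by blast
  have "\<exists>C3 I3. Y = I3 @ C3 \<and> (\<forall>z\<in>set I3. \<not> Q z) \<and> (C3 \<noteq> [] \<longrightarrow> Q (hd C3))"
  proof (cases "\<exists>x\<in>set Y. Q x")
    case True
    then obtain ys x zs where "Y = ys @ x # zs" "Q x" "\<forall>z\<in>set ys. \<not> Q z"
      using split_list_first_prop[of Y Q] by blast
    then show ?thesis
      by (intro exI[of _ "x # zs"] exI[of _ ys]) auto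
  next
    case False
    then show ?thesis by (intro exI[of _ "[]"] exI[of _ Y]) auto
  qed
  then obtain C3 I3 where 3: "Y = I3 @ C3" "\<forall>z\<in>set I3. \<not> Q z" "C3 \<noteq> [] \<longrightarrow> Q (hd C3)"
    by blast
  show ?thesis
    using C 1 3 assms(2) by (intro exI[of _ C1] exI[of _ "I1 @ v # I3"] exI[of _ C3]) auto
qed

text \<open>
  Choose the ear \<open>C\<close> with the largest set \<open>B\<close> of vertices reachable from \<open>A\<close> off \<open>C\<close>. If some
  vertex of \<open>C\<close> is not attached to \<open>B\<close>, a maximal run \<open>I\<close> of such vertices either is separated
  from the rest by its two end neighbours, or is joined to another part of \<open>C\<close> by a path that
  reroutes \<open>C\<close> and releases an attached vertex, so that \<open>B\<close> grows.
\<close>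

lemma attached_ear:
  assumes fin: "finite U"
    and conn: "\<And>F. F \<subseteq> U \<Longrightarrow> F \<noteq> {} \<Longrightarrow> F \<inter> A = {} \<Longrightarrow> nb U F \<noteq> {}"
    and ex: "\<exists>C. ear U L C"
  shows "(\<exists>C. ear U L C \<and> (\<forall>v\<in>set C. v \<in> A \<or> (\<exists>u\<in>reach (U - set C) A. E u v))) \<or> fcase U A L"
proof -
  define b where "b C = card (reach (U - set C) A)" for C
  have bU: "b C \<le> card U" for C
    unfolding b_def using reach_subset[of "U - set C" A] fin by (intro card_mono) auto
  obtain C0 where "ear U L C0" using ex by blast
  then obtain C where C: "ear U L C" and Cmax: "\<And>C'. ear U L C' \<Longrightarrow> b C' \<le> b C"
    using ex_has_greatest_nat[of "ear U L" C0 b "card U + 1"] bU by (metis less_Suc_eq_le Suc_eq_plus1 le_SucI)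
  define B where "B = reach (U - set C) A"
  define att where "att v \<longleftrightarrow> v \<in> A \<or> (\<exists>u\<in>B. E u v)" for v
  have BU: "B \<subseteq> U - set C"
    unfolding B_def by (rule reach_subset)
  have Cp: "path C" "set C \<subseteq> U" "hd C \<in> L" "last C \<in> L"
    using C unfolding ear_def by auto
  have dC: "distinct C"
    using Cp(1) unfolding path_def by auto
  show ?thesis
  proof (cases "\<forall>v\<in>set C. att v")
    case True
    then show ?thesis
      using C unfolding att_def B_def by blast
  next
    case False
    \<comment> \<open>Maximality of \<open>C\<close>: an ear that avoids \<open>B\<close> and leaves
      out an attached vertex \<open>z\<close> would let \<open>z\<close> join the reachable
      set.\<close>
    have grow: False if g: "ear U L C'" "z \<in> set C" "z \<notin> set C'" "att z" "set C' \<inter> B = {}" for C' z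
    proof -
      have BC: "B \<subseteq> reach (U - set C') A"
      proof
        fix x assume "x \<in> B"
        then obtain p where p: "path p" "set p \<subseteq> B" "hd p \<in> A" "last p = x"
          using reachE unfolding B_def by blast
        then show "x \<in> reach (U - set C') A"
          unfolding reach_def using BU g(5) by blast
      qed
      have zC: "z \<in> reach (U - set C') A"
      proof (cases "z \<in> A")
        case True
        then show ?thesis using g Cp(2) by (intro reach_base) auto
      next
        case False
        then obtain u where "u \<in> B" "E u z"
          using g(4) unfolding att_def by blast
        then show ?thesis
          using BC g(2,3) Cp(2) reach_closed[of u "U - set C'" A z] by blast
      qed
      have "z \<notin> B"
        using g(2) BU by auto
      then have "B \<subset> reach (U - set C') A"
        using BC zC by blast
      moreover have "finite (reach (U - set C') A)"
        using fin reach_subset[of "U - set C'" A] finite_subset by blast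
      ultimately have "b C < b C'"
        unfolding b_def B_def[symmetric] by (rule psubset_card_mono[rotated])
      then show False
        using Cmax[OF g(1)] by simp
    qed
    obtain v where v: "v \<in> set C" "\<not> att v" using False by blast
    obtain C1 I C3 where sp: "C = C1 @ I @ C3" "v \<in> set I" "\<forall>z\<in>set I. \<not> att z"
      "C1 \<noteq> [] \<longrightarrow> att (last C1)" "C3 \<noteq> [] \<longrightarrow> att (hd C3)"
      using split_run[of v C att] v by blast
    \<comment> \<open>The attached vertices next to the run are excluded. Hence a path inside
      \<open>W\<close> from the run back to \<open>C\<close> lands beyond one of them, and rerouting
      \<open>C\<close> along it leaves that attached vertex out.\<close>
    define W where "W = U - B - (if C1 = [] then {} else {last C1}) - (if C3 = [] then {} else {hd C3})"
    define F where "F = reach W (set I)"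
    have FW: "F \<subseteq> W" unfolding F_def by (rule reach_subset)
    have disj: "set C1 \<inter> set I = {}" "set C1 \<inter> set C3 = {}" "set I \<inter> set C3 = {}"
      using dC sp(1) by auto
    have IW: "set I \<subseteq> W"
      using Cp(2) sp(1) BU disj unfolding W_def by (auto simp: disjoint_iff split: if_splits)
    have IF: "set I \<subseteq> F"
      unfolding F_def using IW reach_base by blast
    have natt: "\<not> att z" if "z \<in> U - B" "z \<notin> set C1 \<union> set C3" for z
    proof (cases "z \<in> set I")
      case True
      then show ?thesis using sp(3) by blast
    next
      case False
      then have z: "z \<in> U - set C" using that sp(1) by auto
      then show ?thesis
        using that(1) reach_closed[of _ "U - set C" A z] reach_base[of z A "U - set C"]
        unfolding att_def B_def by blast
    qed
    show ?thesis
    proof (cases "F \<inter> (set C1 \<union> set C3) = {}")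
      case False
      then obtain j0 where "j0 \<in> F" "j0 \<in> set C1 \<union> set C3" by blast
      then obtain p where p: "path p" "set p \<subseteq> F" "hd p \<in> set I" "last p = j0"
        using reachE[of j0 W "set I"] unfolding F_def by blast
      have "\<exists>x\<in>set p. x \<in> set C1 \<union> set C3"
        using p \<open>j0 \<in> set C1 \<union> set C3\<close> path_nonempty[OF p(1)] by (metis last_in_set)
      then obtain p1 j p2 where p1: "p = p1 @ j # p2" "j \<in> set C1 \<union> set C3"
        "\<forall>y\<in>set p1. y \<notin> set C1 \<union> set C3"
        using split_list_first_prop[of p "\<lambda>x. x \<in> set C1 \<union> set C3"] by blast
      have p1n: "p1 \<noteq> []"
        using p(3) p1 disj by (cases p1) auto
      then have "\<exists>x\<in>set p1. x \<in> set I"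
        using p(3) p1(1) by (intro bexI[of _ "hd p1"]) auto
      then obtain r i q' where q': "p1 = r @ i # q'" "i \<in> set I" "\<forall>y\<in>set q'. y \<notin> set I"
        using split_list_last_prop[of p1 "\<lambda>x. x \<in> set I"] by blast
      let ?q = "i # q' @ [j]"
      have pq: "path ?q"
      proof -
        have "path (r @ ?q @ p2)" using p(1) p1(1) q'(1) by simp
        then show ?thesis
          using path_appendD2[of r "?q @ p2"] path_appendD1[of ?q p2] by simp
      qed
      have q'C: "set q' \<inter> set C = {}"
        using q' p1(3) sp(1) by auto
      have qU: "set ?q \<subseteq> U - B"
        using p(2) p1(1) q'(1) FW unfolding W_def by auto
      have jW: "j \<in> W" using p(2) p1(1) FW by auto
      obtain I1 I2 where I: "I = I1 @ i # I2"
        using q'(2) split_list by metis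
      show ?thesis
      proof (cases "j \<in> set C1")
        case True
        then obtain Ca Cb where Cab: "C1 = Ca @ j # Cb" using split_list by metis
        have Cbn: "Cb \<noteq> []"
          using jW True Cab unfolding W_def by (auto split: if_splits)
        let ?rr = "j # rev q' @ [i]"
        have prr: "path ?rr"
          using pq path_rev[of ?q] by simp
        have C': "C = Ca @ (j # Cb @ I1 @ [i]) @ (I2 @ C3)"
          using sp(1) Cab I by simp
        have pC': "path (Ca @ ?rr @ (I2 @ C3))"
        proof (rule path_subst[of Ca "j # Cb @ I1 @ [i]"])
          show "path (Ca @ (j # Cb @ I1 @ [i]) @ (I2 @ C3))"
            using Cp(1) C' by simp
          show "set ?rr \<inter> (set Ca \<union> set (I2 @ C3)) = {}"
            using q'C C' dC by auto
          show "Ca \<noteq> [] \<Longrightarrow> E (last Ca) (hd ?rr)"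
            using Cp(1) C' path_append[of Ca "j # Cb @ I1 @ i # I2 @ C3"] by simp
          show "I2 @ C3 \<noteq> [] \<Longrightarrow> E (last ?rr) (hd (I2 @ C3))"
            using Cp(1) C' path_append[of "Ca @ j # Cb @ I1 @ [i]" "I2 @ C3"] by simp
        qed (rule prr)
        have "hd (Ca @ ?rr @ (I2 @ C3)) \<in> L"
          using Cp(3) C' by (cases "Ca = []") auto
        moreover have "last (Ca @ ?rr @ (I2 @ C3)) \<in> L"
          using Cp(4) C' by (cases "I2 @ C3 = []") auto
        moreover have "set (Ca @ ?rr @ (I2 @ C3)) \<subseteq> U"
          using Cp(2) C' qU by auto
        ultimately have e: "ear U L (Ca @ ?rr @ (I2 @ C3))"
          unfolding ear_def using pC' by auto
        have l: "last C1 = last Cb" "last Cb \<in> set Cb"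
          using Cab Cbn by auto
        have "set (Ca @ ?rr @ (I2 @ C3)) \<inter> B = {}"
          using BU C' qU by auto
        moreover have "last C1 \<notin> set (Ca @ ?rr @ (I2 @ C3))" "last C1 \<in> set C"
          using l dC C' q'C by auto
        moreover have "att (last C1)" using sp(4) True by auto
        ultimately have False
          using grow[OF e] by blast
        then show ?thesis ..
      next
        case False
        then have jC3: "j \<in> set C3" using p1(2) by auto
        then obtain Ca Cb where Cab: "C3 = Ca @ j # Cb" using split_list by metis
        have Can: "Ca \<noteq> []"
          using jW jC3 Cab unfolding W_def by (auto split: if_splits)
        have C': "C = (C1 @ I1) @ (i # I2 @ Ca @ [j]) @ Cb"
          using sp(1) Cab I by simp
        have pC': "path ((C1 @ I1) @ ?q @ Cb)"
        proof (rule path_subst[of "C1 @ I1" "i # I2 @ Ca @ [j]"])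
          show "path ((C1 @ I1) @ (i # I2 @ Ca @ [j]) @ Cb)"
            using Cp(1) C' by simp
          show "set ?q \<inter> (set (C1 @ I1) \<union> set Cb) = {}"
            using q'C C' dC by auto
          show "C1 @ I1 \<noteq> [] \<Longrightarrow> E (last (C1 @ I1)) (hd ?q)"
            using Cp(1) C' path_append[of "C1 @ I1" "(i # I2 @ Ca @ [j]) @ Cb"] by simp
          show "Cb \<noteq> [] \<Longrightarrow> E (last ?q) (hd Cb)"
            using Cp(1) C' path_append[of "(C1 @ I1) @ (i # I2 @ Ca @ [j])" Cb] by simp
        qed (rule pq)
        have "hd ((C1 @ I1) @ ?q @ Cb) \<in> L"
          using Cp(3) C' by (cases C1; cases I1) auto
        moreover have "last ((C1 @ I1) @ ?q @ Cb) \<in> L"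
          using Cp(4) C' by (cases "Cb = []") auto
        moreover have "set ((C1 @ I1) @ ?q @ Cb) \<subseteq> U"
          using Cp(2) C' qU by auto
        ultimately have e: "ear U L ((C1 @ I1) @ ?q @ Cb)"
          unfolding ear_def using pC' by auto
        have l: "hd C3 = hd Ca" "hd Ca \<in> set Ca"
          using Cab Can by auto
        have "set ((C1 @ I1) @ ?q @ Cb) \<inter> B = {}"
          using BU C' qU by auto
        moreover have "hd C3 \<notin> set ((C1 @ I1) @ ?q @ Cb)" "hd C3 \<in> set C"
          using l dC C' q'C by auto
        moreover have "att (hd C3)" using sp(5) jC3 by auto
        ultimately have False
          using grow[OF e] by blast
        then show ?thesis ..
      qed
    next
      case FC: True
      have nattF: "\<not> att z" if "z \<in> F" for z
        using that natt FC FW unfolding W_def by auto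
      have nbF: "nb U F \<subseteq> (if C1 = [] then {} else {last C1}) \<union> (if C3 = [] then {} else {hd C3})"
      proof
        fix z assume "z \<in> nb U F"
        then obtain f where f: "f \<in> F" "E f z" "z \<in> U - F" unfolding nb_def by auto
        have "z \<notin> B"
          using nattF[OF f(1)] sym[OF f(2)] unfolding att_def by blast
        moreover have "z \<notin> W"
          using f reach_closed[of f W "set I" z] unfolding F_def by auto
        ultimately show "z \<in> (if C1 = [] then {} else {last C1}) \<union> (if C3 = [] then {} else {hd C3})"
          using f(3) unfolding W_def by auto
      qed
      have FA: "F \<subseteq> U - A" "F \<noteq> {}"
        using nattF FW IF sp(2) unfolding att_def W_def by auto
      have attpath: "\<exists>w. path w \<and> hd w \<in> A \<and> last w = z \<and> set w \<subseteq> insert z B"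
        if z: "z \<in> set C" "att z" for z
      proof (cases "z \<in> A")
        case True
        then show ?thesis by (intro exI[of _ "[z]"]) (auto simp: path_sing)
      next
        case False
        then obtain u where u: "u \<in> B" "E u z" using z(2) unfolding att_def by blast
        then obtain p where p: "path p" "set p \<subseteq> B" "hd p \<in> A" "last p = u"
          using reachE unfolding B_def by metis
        then have "path (p @ [z])"
          using u path_nonempty[OF p(1)] z(1) BU by (subst path_append) (auto simp: path_sing)
        then show ?thesis
          using p path_nonempty[OF p(1)] by (intro exI[of _ "p @ [z]"]) auto
      qed
      have BF: "B \<inter> F = {}" using FW unfolding W_def by auto
      consider "C1 = []" "C3 = []" | "C1 \<noteq> []" "C3 = []" | "C1 = []" "C3 \<noteq> []" | "C1 \<noteq> []" "C3 \<noteq> []"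
        by blast
      then show ?thesis
      proof cases
        case 1
        \<comment> \<open>The run is all of \<open>C\<close>, so no vertex of \<open>U - B\<close>
          is attached and this set has no neighbours, against \<open>conn\<close>.\<close>
        have nB: "\<not> att z" if "z \<in> U - B" for z
          using natt[OF that] 1 by auto
        then have "(U - B) \<inter> A = {}" unfolding att_def by blast
        moreover have "U - B \<noteq> {}" using v(1) Cp(2) BU by auto
        moreover have "nb U (U - B) = {}"
          using nB sym unfolding nb_def att_def by blast
        ultimately have False using conn[of "U - B"] by auto
        then show ?thesis ..
      next
        case 2
        then have l: "last C1 \<in> set C1" by simp
        obtain w where w: "path w" "hd w \<in> A" "last w = last C1" "set w \<subseteq> insert (last C1) B"
          using attpath[of "last C1"] sp(1,4) 2 l by auto
        have "last C1 \<in> U - F"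
          using FC Cp(2) sp(1) l by auto
        then have "set w \<subseteq> U - F"
          using w(4) BF BU by blast
        then have "fcase U A L"
          unfolding fcase_def using FA nbF 2 w
          by (intro exI[of _ F] exI[of _ w] exI[of _ "[]"]) simp
        then show ?thesis ..
      next
        case 3
        then have l: "hd C3 \<in> set C3" by simp
        obtain w where w: "path w" "hd w \<in> A" "last w = hd C3" "set w \<subseteq> insert (hd C3) B"
          using attpath[of "hd C3"] sp(1,5) 3 l by auto
        have "hd C3 \<in> U - F"
          using FC Cp(2) sp(1) l by auto
        then have "set w \<subseteq> U - F"
          using w(4) BF BU by blast
        then have "fcase U A L"
          unfolding fcase_def using FA nbF 3 w
          by (intro exI[of _ F] exI[of _ w] exI[of _ "[]"]) simp
        then show ?thesis ..
      next
        case 4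
        then have l: "last C1 \<in> set C1" "hd C3 \<in> set C3" by auto
        \<comment> \<open>Otherwise the ear can turn from the run through \<open>F\<close> straight
          to y, which leaves out the attached vertex \<open>hd C3\<close>.\<close>
        have FL: "F \<inter> L = {}"
        proof (rule ccontr)
          assume "F \<inter> L \<noteq> {}"
          then obtain l0 where l0: "l0 \<in> F" "l0 \<in> L" by blast
          then obtain p where p: "path p" "set p \<subseteq> F" "hd p \<in> set I" "last p = l0"
            using reachE[of l0 W "set I"] unfolding F_def by blast
          have "\<exists>x\<in>set p. x \<in> set I"
            using p(3) path_nonempty[OF p(1)] by (intro bexI[of _ "hd p"]) auto
          then obtain r i q' where q': "p = r @ i # q'" "i \<in> set I" "\<forall>y\<in>set q'. y \<notin> set I"
            using split_list_last_prop[of p "\<lambda>x. x \<in> set I"] by blast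
          obtain I1 I2 where I: "I = I1 @ i # I2"
            using q'(2) split_list by metis
          let ?C = "(C1 @ I1) @ (i # q') @ []"
          have C': "C = (C1 @ I1) @ (i # I2 @ C3)"
            using sp(1) I by simp
          have q'C: "set q' \<inter> set C = {}"
            using q' p(2) FC sp(1) by auto
          have pC': "path ?C"
          proof (rule path_subst[of "C1 @ I1" "i # I2 @ C3"])
            show "path ((C1 @ I1) @ (i # I2 @ C3) @ [])"
              using Cp(1) C' by simp
            show "path (i # q')"
              using p(1) q'(1) path_appendD2 by blast
            show "set (i # q') \<inter> (set (C1 @ I1) \<union> set []) = {}"
              using q'C C' dC by auto
            show "C1 @ I1 \<noteq> [] \<Longrightarrow> E (last (C1 @ I1)) (hd (i # q'))"
              using Cp(1) C' path_append[of "C1 @ I1" "i # I2 @ C3"] by simp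
          qed simp
          have "hd ?C \<in> L"
            using Cp(3) C' 4 by auto
          moreover have "last ?C \<in> L"
            using p(4) l0(2) q'(1) by auto
          moreover have "set ?C \<subseteq> U"
            using Cp(2) C' p(2) q'(1) FW unfolding W_def by auto
          moreover have "2 \<le> length ?C"
            using 4 by (cases C1) auto
          ultimately have e: "ear U L ?C"
            unfolding ear_def using pC' by blast
          have "set ?C \<inter> B = {}"
            using BU C' p(2) q'(1) BF by auto
          moreover have "hd C3 \<notin> set ?C" "hd C3 \<in> set C"
            using l dC C' q'C by auto
          ultimately show False
            using grow[OF e] sp(5) 4 by blast
        qed
        obtain w where w: "path w" "hd w \<in> A" "last w = last C1" "set w \<subseteq> insert (last C1) B"
          using attpath[of "last C1"] sp(1,4) 4 l by auto
        have "path C3"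
          using Cp(1) sp(1) 4 path_appendD2[of "C1 @ I" C3] by simp
        moreover have "last C3 \<in> L"
          using Cp(4) sp(1) 4 by simp
        moreover have "set w \<inter> set C3 = {}"
          using w(4) l disj BU sp(1) by auto
        moreover have "set C3 \<subseteq> U - F" "set w \<subseteq> U - F"
          using FC Cp(2) sp(1) w(4) BF BU l by auto
        ultimately have "fcase U A L"
          unfolding fcase_def using FA nbF 4 w FL
          by (intro exI[of _ F] exI[of _ w] exI[of _ C3]) auto
        then show ?thesis ..
      qed
    qed
  qed
qed

text \<open>
  On a cycle of length \<open>2 * l\<close> through \<open>y\<close>, a vertex at distance \<open>l - 1\<close> from \<open>y\<close> is joined to
  \<open>y\<close> by two arcs whose lengths differ by 2.
\<close>

lemma lollipop:
  assumes fin: "finite U" and mL: "monochromatic L"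
    and conn: "\<And>F. F \<subseteq> U \<Longrightarrow> F \<noteq> {} \<Longrightarrow> F \<inter> A = {} \<Longrightarrow> nb U F \<noteq> {}"
    and ex: "\<exists>C. ear U L C"
  shows "(\<exists>p\<in>A. \<exists>a. fam a U {p} L 2) \<or> fcase U A L"
proof -
  have "\<exists>p\<in>A. \<exists>a. fam a U {p} L 2"
    if C: "ear U L C" "\<forall>v\<in>set C. v \<in> A \<or> (\<exists>u\<in>reach (U - set C) A. E u v)" for C
  proof -
    define B where "B = reach (U - set C) A"
    have BU: "B \<subseteq> U - set C"
      unfolding B_def by (rule reach_subset)
    have Cp: "path C" "set C \<subseteq> U" "hd C \<in> L" "last C \<in> L" "2 \<le> length C"
      using C unfolding ear_def by auto
    have "odd (length C)"
      using path_parity[OF Cp(1)] Cp(3,4) mL unfolding monochromatic_def by blast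
    then obtain q where q: "length C = 2 * q + 1"
      by (rule oddE)
    define m where "m = q - 1"
    have m: "length C = 2 * m + 3"
      using q Cp(5) unfolding m_def by linarith
    \<comment> \<open>Position \<open>m\<close> of the \<open>2 * m + 3\<close> vertices leaves
      \<open>m\<close> on one side and \<open>m + 2\<close> on the other.\<close>
    define X v Y where "X = take m C" and "v = C ! m" and "Y = drop (Suc m) C"
    have XvY: "C = X @ v # Y"
      unfolding X_def v_def Y_def using m by (intro id_take_nth_drop) auto
    have len: "length X = m" "length Y = m + 2"
      unfolding X_def Y_def using m by auto
    have Yn: "Y \<noteq> []" using len by auto
    have "\<exists>w. path w \<and> hd w \<in> A \<and> last w = v \<and> set w \<subseteq> insert v B"
    proof (cases "v \<in> A")
      case True
      then show ?thesis by (intro exI[of _ "[v]"]) (auto simp: path_sing)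
    next
      case False
      then obtain u where u: "u \<in> B" "E u v" using C(2) XvY unfolding B_def by auto
      then obtain p where p: "path p" "set p \<subseteq> B" "hd p \<in> A" "last p = u"
        using reachE unfolding B_def by metis
      then have "path (p @ [v])"
        using u path_nonempty[OF p(1)] XvY BU by (subst path_append) (auto simp: path_sing)
      then show ?thesis
        using p path_nonempty[OF p(1)] by (intro exI[of _ "p @ [v]"]) auto
    qed
    then obtain w where w: "path w" "hd w \<in> A" "last w = v" "set w \<subseteq> insert v B" by blast
    have wn: "w \<noteq> []" using w(1) by (rule path_nonempty)
    have dC: "distinct C" using Cp(1) unfolding path_def by auto
    have dis: "set w \<inter> set X = {}" "set w \<inter> set Y = {}"
      using w(4) BU XvY dC by auto
    have wU: "set w \<subseteq> U" using w(4) BU Cp(2) XvY by auto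
    have pX: "path (w @ rev X)"
    proof (cases "X = []")
      case False
      then have "path X" "E (last X) v"
        using Cp(1) XvY path_append[of X "v # Y"] by auto
      then show ?thesis
        using False w wn dis sym by (subst path_append) (auto simp: path_rev hd_rev)
    qed (use w in simp)
    have pY: "path (w @ Y)"
    proof -
      have "path (v # Y)" using Cp(1) XvY path_appendD2 by blast
      then have "path Y" "E v (hd Y)" using Yn by (auto simp: path_Cons)
      then show ?thesis using w wn Yn dis by (subst path_append) auto
    qed
    have lX: "last (w @ rev X) \<in> L"
      using Cp(3) XvY w(3) wn by (cases "X = []") (auto simp: last_rev)
    have lY: "last (w @ Y) \<in> L"
      using Cp(4) XvY Yn by auto
    have "fam (length w + m) U {hd w} L 2"
      unfolding fam_def
    proof (intro allI impI)
      fix i :: nat assume "i < 2"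
      then consider "i = 0" | "i = 1" by linarith
      then show "\<exists>p. path p \<and> set p \<subseteq> U \<and> hd p \<in> {hd w} \<and> last p \<in> L \<and> length p = length w + m + 2 * i"
      proof cases
        case 1
        then show ?thesis
          using pX lX wU Cp(2) XvY wn len by (intro exI[of _ "w @ rev X"]) auto
      next
        case 2
        then show ?thesis
          using pY lY wU Cp(2) XvY wn len by (intro exI[of _ "w @ Y"]) auto
      qed
    qed
    then show ?thesis using w(2) by blast
  qed
  then show ?thesis
    using attached_ear[OF fin conn ex] by blast
qed

subsection \<open>Complete bipartite cores\<close>

text \<open>
  With the virtual root \<open>x\<close> added to \<open>S\<close>, the pair \<open>S\<close>, \<open>T\<close> is a complete bipartite subgraph at \<open>x\<close>.
  A minimal piece \<open>G\<close> hanging at a cut vertex towards \<open>y\<close> loses at most \<open>card S\<close> from its degrees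
  when \<open>T\<close> is contracted to a new root and \<open>x\<close>, \<open>S\<close> are deleted; the \<open>card S + 1\<close> path lengths from
  \<open>x\<close> to \<open>T\<close> compensate the loss. If \<open>G\<close> meets only \<open>S\<close>, one contracts \<open>S\<close> instead, which needs
  \<open>card S \<ge> 2\<close>. The second disjunct is the remaining case, a piece with at most three neighbours,
  one of them \<open>x\<close>.
\<close>

lemma core_step:
  assumes fin: "finite D" and subs: "M \<subseteq> D" "L \<subseteq> D" "monochromatic M" "monochromatic L"
    and IH: "\<And>D' M' L' k'. adm D' M' L' k' \<Longrightarrow> card D' < card D \<Longrightarrow> \<exists>a. fam a D' M' L' k'"
    and S: "S \<subseteq> D" and T: "T \<subseteq> M" and ST: "\<And>u t. u \<in> S \<Longrightarrow> t \<in> T \<Longrightarrow> E u t"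
    and card: "card S < card T"
    and alpha: "\<And>v. v \<in> D - (S \<union> T) \<Longrightarrow> card {t \<in> T. E v t} \<le> card S + 1"
    and beta: "\<And>v. v \<in> D - (S \<union> T) \<Longrightarrow> card {u \<in> S. E v u} + of_bool (v \<in> M) \<le> card S"
    and deg: "\<And>v. v \<in> D - (S \<union> T) \<Longrightarrow> k + 1 \<le> cut D M L {v}"
    and exit: "L - (S \<union> T) \<noteq> {}"
  shows "(\<exists>a. fam a D M L k) \<or>
    (\<exists>G. G \<noteq> {} \<and> G \<subseteq> D - (S \<union> T) \<and> nb D G \<inter> T = {} \<and> card (nb D G) + of_bool (G \<inter> L \<noteq> {}) \<le> 2)"
proof -
  define Q where "Q = S \<union> T"
  define A where "A = reach (D - Q) L"
  \<comment> \<open>The size of the boundary of \<open>G\<close> when the core and x are deleted but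
    y is kept. A smallest nonempty \<open>G\<close> with \<open>w G \<le> 1\<close> plays the role
    of an end block without its cut vertex; y itself may be that cut vertex.\<close>
  define w where "w G = card (nb A G) + of_bool (G \<inter> L \<noteq> {})" for G
  have finS: "finite S" "finite T" "finite Q"
    using finite_subset[OF S fin] finite_subset[OF subset_trans[OF T subs(1)] fin] unfolding Q_def by auto
  have AD: "A \<subseteq> D - Q"
    unfolding A_def by (rule reach_subset)
  have finA: "finite A"
    using AD fin finite_subset by blast
  obtain t0 where t0: "t0 \<in> T"
    using card by fastforce
  have Q: "Q \<subseteq> D" "Q \<inter> A = {}"
    using S T subs(1) AD unfolding Q_def by auto
  have "A \<noteq> {}"
  proof -
    obtain l where "l \<in> L" "l \<notin> Q"
      using exit unfolding Q_def by blast
    then show ?thesis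
      using reach_base[of l L "D - Q"] subs(2) unfolding A_def by auto
  qed
  moreover have "w A \<le> 1"
    unfolding w_def nb_def by (auto simp: of_bool_def)
  ultimately obtain G where G: "G \<subseteq> A" "G \<noteq> {}" "w G \<le> 1"
    and Gmin: "\<And>F. F \<subseteq> A \<Longrightarrow> F \<noteq> {} \<Longrightarrow> w F \<le> 1 \<Longrightarrow> card G \<le> card F"
    using ex_has_least_nat[of "\<lambda>G. G \<subseteq> A \<and> G \<noteq> {} \<and> w G \<le> 1" A card] by blast
  have finG: "finite G"
    using G(1) finA finite_subset by blast
  have w1: "1 \<le> w F" if F: "F \<subseteq> A" "F \<noteq> {}" for F
  proof (rule ccontr)
    assume "\<not> 1 \<le> w F"
    then have "card (nb A F) = 0" and zL: "F \<inter> L = {}"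
      unfolding w_def by (auto simp: of_bool_def split: if_splits)
    then have z: "nb A F = {}" "F \<inter> L = {}"
      using finite_nb[OF finA, of F] by simp_all
    obtain f where f: "f \<in> F" using F by blast
    then have "f \<in> A" using F by blast
    then obtain p where p: "path p" "set p \<subseteq> A" "hd p \<in> L" "last p = f"
      using reachE unfolding A_def by blast
    have pn: "p \<noteq> []" using p(1) by (rule path_nonempty)
    have "set p \<subseteq> A - F"
    proof (rule closed_path[of p "A - F" A])
      show "successively E p" using p(1) unfolding path_def by blast
      show "hd p \<in> A - F" using p(2,3) z(2) pn by auto
      fix a b assume "a \<in> A - F" "E a b" "b \<in> A"
      then show "b \<in> A - F"
        using z(1) sym unfolding nb_def by blast
    qed (use p pn in auto)
    then show False
      using p(4) f pn last_in_set by blast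
  qed
  have w2: "2 \<le> w F" if F: "F \<subset> G" "F \<noteq> {}" for F
  proof (rule ccontr)
    assume "\<not> 2 \<le> w F"
    then have "card G \<le> card F"
      using Gmin[of F] F G(1) by auto
    then show False
      using F(1) finG psubset_card_mono[of G F] by simp
  qed
  have nbA: "nb D F \<subseteq> nb A F \<union> {q \<in> Q. \<exists>v\<in>F. E v q}" if F: "F \<subseteq> A" for F
  proof
    fix z assume "z \<in> nb D F"
    then obtain v where v: "v \<in> F" "E v z" "z \<in> D - F" unfolding nb_def by auto
    show "z \<in> nb A F \<union> {q \<in> Q. \<exists>v\<in>F. E v q}"
    proof (cases "z \<in> Q")
      case False
      then have "z \<in> A"
        using v F reach_closed[of v "D - Q" L z] unfolding A_def by auto
      then show ?thesis using v unfolding nb_def by auto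
    qed (use v in auto)
  qed
  \<comment> \<open>\<open>L'\<close> is the neighbourhood in \<open>G\<close> of its only
    attachment: y, or a vertex \<open>b\<close> from which a path outside \<open>G\<close> leads on
    to y. That path has one fixed length, so no term of a progression is lost.\<close>
  have "\<exists>L'. L' \<subseteq> G \<and> monochromatic L' \<and> (\<forall>F\<subseteq>G. w F \<le> card (nb G F) + of_bool (F \<inter> L' \<noteq> {})) \<and>
      (\<forall>a N j. 1 \<le> j \<longrightarrow> fam a G N L' j \<longrightarrow> (\<exists>a'. fam a' A N L j))"
  proof (cases "G \<inter> L = {}")
    case False
    then have n: "nb A G = {}"
      using G(3) finite_nb[OF finA, of G] unfolding w_def by auto
    have "w F \<le> card (nb G F) + of_bool (F \<inter> (G \<inter> L) \<noteq> {})" if F: "F \<subseteq> G" for F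
    proof -
      have "nb A F \<subseteq> nb G F"
        using n F unfolding nb_def by blast
      then have "card (nb A F) \<le> card (nb G F)"
        using finG finite_nb card_mono by blast
      moreover have "F \<inter> (G \<inter> L) = F \<inter> L" using F by blast
      ultimately show ?thesis unfolding w_def by simp
    qed
    moreover have "\<exists>a'. fam a' A N L j" if "fam a G N (G \<inter> L) j" for a N j
      using fam_mono[OF that order_refl G(1) order_refl, of L] by auto
    ultimately show ?thesis
      using subs(4) monochromatic_Int by (intro exI[of _ "G \<inter> L"]) blast
  next
    case True
    then have "card (nb A G) = 1"
      using w1[of G] G unfolding w_def by auto
    then obtain b where b: "nb A G = {b}" by (auto simp: card_1_singleton_iff)
    then have bA: "b \<in> A" "b \<notin> G" unfolding nb_def by auto
    then obtain p where p: "path p" "set p \<subseteq> A" "hd p \<in> L" "last p = b"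
      using reachE unfolding A_def by blast
    have pn: "p \<noteq> []" using p(1) by (rule path_nonempty)
    have pG: "set p \<inter> G = {}"
    proof (rule ccontr)
      assume "set p \<inter> G \<noteq> {}"
      then obtain ys x zs where sp: "p = ys @ x # zs" "x \<in> G" "\<forall>y\<in>set ys. y \<notin> G"
        using split_list_first_prop[of p "\<lambda>x. x \<in> G"] by blast
      have yn: "ys \<noteq> []"
        using sp p(3) True by (cases ys) auto
      have "E (last ys) x"
        using p(1) sp(1) yn path_append[of ys "x # zs"] by simp
      moreover have "last ys \<in> A" "last ys \<notin> G"
        using p(2) sp yn by auto
      ultimately have "last ys = b"
        using b sp(2) sym unfolding nb_def by blast
      moreover have "b \<in> set (x # zs)"
        using p(4) sp(1) by (metis last_appendR last_in_set list.distinct(1))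
      moreover have "last ys \<in> set ys" using yn by simp
      ultimately show False
        using p(1) sp(1) unfolding path_def by auto
    qed
    have tail: "fam (length p) (set p) {b} L 1"
      using fam_mono[OF fam_rev[OF fam_path[OF p(1)]], of 1 "set p" "{b}" L] p(3,4) by auto
    have wF: "w F \<le> card (nb G F) + of_bool (F \<inter> (G \<inter> {u. E u b}) \<noteq> {})" if F: "F \<subseteq> G" for F
    proof -
      define X where "X = (if F \<inter> (G \<inter> {u. E u b}) \<noteq> {} then {b} else {})"
      have "nb A F \<subseteq> nb G F \<union> X"
      proof
        fix z assume "z \<in> nb A F"
        then obtain v where v: "v \<in> F" "E v z" "z \<in> A - F" unfolding nb_def by auto
        show "z \<in> nb G F \<union> X"
        proof (cases "z \<in> G")
          case False
          then have "z \<in> nb A G" using v F unfolding nb_def by auto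
          then show ?thesis using b v F unfolding X_def by auto
        qed (use v in \<open>auto simp: nb_def\<close>)
      qed
      moreover have "finite X" unfolding X_def by auto
      ultimately have "card (nb A F) \<le> card (nb G F \<union> X)"
        using finite_nb[OF finG] by (intro card_mono) auto
      also have "\<dots> \<le> card (nb G F) + card X" by (rule card_Un_le)
      finally have "card (nb A F) \<le> card (nb G F) + card X" .
      moreover have "card X = of_bool (F \<inter> (G \<inter> {u. E u b}) \<noteq> {})"
        unfolding X_def by simp
      moreover have "F \<inter> L = {}" using True F by blast
      ultimately show ?thesis
        unfolding w_def by simp
    qed
    have ext: "\<exists>a'. fam a' A N L j" if j: "1 \<le> j" "fam a G N (G \<inter> {u. E u b}) j" for a N j
    proof -
      have "fam (a + length p) (G \<union> set p) N L j"
      proof (rule fam_concat[OF _ tail])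
        fix m assume "m \<in> {b}"
        then show "fam a G N {l. E l m} j"
          using fam_mono[OF j(2), of j G N "{l. E l m}"] by auto
      qed (use pG j(1) in auto)
      then show ?thesis
        using fam_mono[of _ "G \<union> set p" N L j j A N L] G(1) p(2) by blast
    qed
    show ?thesis
    proof (intro exI[of _ "G \<inter> {u. E u b}"] conjI allI impI)
      show "monochromatic (G \<inter> {u. E u b})"
        by (rule monochromatic_Int[OF monochromatic_nbrs(2)])
    qed (use wF ext in simp_all)
  qed
  then obtain L' where L': "L' \<subseteq> G" "monochromatic L'"
    and wcut: "\<And>F. F \<subseteq> G \<Longrightarrow> w F \<le> card (nb G F) + of_bool (F \<inter> L' \<noteq> {})"
    and tail: "\<And>a N j. 1 \<le> j \<Longrightarrow> fam a G N L' j \<Longrightarrow> \<exists>a'. fam a' A N L j"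
    by blast
  \<comment> \<open>The degree that \<open>v\<close> loses with the core and x.\<close>
  define c where "c v = card {t \<in> T. E v t} + card {u \<in> S. E v u} + of_bool (v \<in> M)" for v
  have degw: "k + 1 \<le> w {v} + c v" if v: "v \<in> G" for v
  proof -
    have vA: "v \<in> A" "v \<in> D - (S \<union> T)" using v G(1) AD unfolding Q_def by auto
    have "nb D {v} \<subseteq> nb A {v} \<union> ({t \<in> T. E v t} \<union> {u \<in> S. E v u})"
      using nbA[of "{v}"] vA(1) unfolding Q_def by auto
    then have "card (nb D {v}) \<le> card (nb A {v} \<union> ({t \<in> T. E v t} \<union> {u \<in> S. E v u}))"
      using finite_nb[OF finA] finS by (intro card_mono) auto
    also have "\<dots> \<le> card (nb A {v}) + card ({t \<in> T. E v t} \<union> {u \<in> S. E v u})"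
      by (rule card_Un_le)
    also have "\<dots> \<le> card (nb A {v}) + (card {t \<in> T. E v t} + card {u \<in> S. E v u})"
      using card_Un_le by (intro add_left_mono)
    finally show ?thesis
      using deg[OF vA(2)] unfolding cut_def w_def c_def by (auto simp: of_bool_def split: if_splits)
  qed
  have cardG: "card G < card D"
    using G(1) AD Q(1) t0 fin unfolding Q_def
    by (intro psubset_card_mono) auto
  \<comment> \<open>The new root returns one unit of degree to its neighbours \<open>N\<close>. For
    \<open>j \<le> 1\<close> a degree of 2 is enough, and the cut condition supplies it; hence the
    \<open>max 1\<close> in the choices of \<open>j\<close> below.\<close>
  have admG: "adm G N L' j" if N: "N \<subseteq> G" "N \<noteq> {}" "monochromatic N"
    and d: "\<And>v. v \<in> G \<Longrightarrow> j \<le> 1 \<or> j + c v \<le> k + of_bool (v \<in> N)" for N j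
  proof -
    have ge: "w F + of_bool (F \<inter> N \<noteq> {}) \<le> cut G N L' F" if "F \<subseteq> G" for F
      using wcut[OF that] unfolding cut_def by auto
    have two: "2 \<le> cut G N L' F" if F: "F \<subseteq> G" "F \<noteq> {}" for F
    proof (cases "F = G")
      case True
      then show ?thesis
        using ge[of G] w1[of G] G N by (auto simp: Int_absorb1)
    next
      case False
      then have "F \<subset> G" using F by blast
      then show ?thesis
        using ge[of F] w2[of F] F by linarith
    qed
    show ?thesis
      unfolding adm_def
    proof (intro conjI ballI allI impI)
      fix v assume v: "v \<in> G"
      show "j + 1 \<le> cut G N L' {v}"
        using d[OF v] degw[OF v] ge[of "{v}"] two[of "{v}"] v by (auto simp: of_bool_def split: if_splits)
    qed (use finG G N L' two in auto)
  qed
  have colT: "col t = col t0" if "t \<in> T" for t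
    using that t0 T subs(3) unfolding monochromatic_def by blast
  have colS: "col u \<noteq> col t0" if "u \<in> S" for u
    using bip ST[OF that t0] by blast
  define N1 where "N1 = G \<inter> {v. \<exists>t\<in>T. E t v}"
  define N2 where "N2 = G \<inter> {v. \<exists>u\<in>S. E u v}"
  have GD: "G \<subseteq> D - (S \<union> T)" using G(1) AD unfolding Q_def by blast
  have join: "\<exists>a. fam a D M L k" if N: "adm G N L' j" "1 \<le> j" "1 \<le> i" "k + 1 \<le> i + j"
    and f: "\<And>m. m \<in> N \<Longrightarrow> fam a0 Q T {l. E l m} i" for N i j a0
  proof -
    obtain a where "fam a G N L' j" using IH[OF N(1) cardG] by blast
    then obtain a' where a': "fam a' A N L j" using tail[OF N(2)] by blast
    have "fam (a0 + a') (Q \<union> A) T L k"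
      by (rule fam_concat[OF f a' Q(2) N(3,2,4)])
    then show ?thesis
      using fam_mono[of _ "Q \<union> A" T L k k D M L] Q(1) AD T by blast
  qed
  consider "N1 \<noteq> {}" | "N1 = {}" "N2 \<noteq> {}" "2 \<le> card S" | "N1 = {}" "N2 = {} \<or> card S \<le> 1"
    by linarith
  then show ?thesis
  proof cases
    case 1
    \<comment> \<open>The \<open>card S + 1\<close> lengths inside the core make up for a loss of
      \<open>card S\<close>. Neighbours of \<open>T\<close> may lose one more, since they are
      adjacent to the new root; by colour they lose nothing to \<open>S\<close> and x.\<close>
    define j where "j = max 1 (k - card S)"
    have col1: "col v \<noteq> col t0" if "v \<in> N1" for v
      using that bip colT unfolding N1_def by blast
    have a1: "adm G N1 L' j"
    proof (rule admG[OF _ 1])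
      show "N1 \<subseteq> G" unfolding N1_def by blast
      show "monochromatic N1" using col1 unfolding monochromatic_def by blast
      fix v assume v: "v \<in> G"
      show "j \<le> 1 \<or> j + c v \<le> k + of_bool (v \<in> N1)"
      proof (cases "v \<in> N1")
        case True
        have "v \<notin> M"
          using col1[OF True] t0 T subs(3) unfolding monochromatic_def by blast
        moreover have "{u \<in> S. E v u} = {}"
          using col1[OF True] colS bip by blast
        then have "card {u \<in> S. E v u} = 0" by (simp only: card.empty)
        moreover have "card {t \<in> T. E v t} \<le> card S + 1"
          using v GD by (intro alpha) blast
        ultimately have "c v \<le> card S + 1"
          unfolding c_def by simp
        then show ?thesis using True unfolding j_def by auto
      next
        case False
        then have "{t \<in> T. E v t} = {}" using v sym unfolding N1_def by blast
        then have "card {t \<in> T. E v t} = 0" by (simp only: card.empty)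
        moreover have "card {u \<in> S. E v u} + of_bool (v \<in> M) \<le> card S"
          using v GD by (intro beta) blast
        ultimately have "c v \<le> card S"
          unfolding c_def by simp
        then show ?thesis unfolding j_def by auto
      qed
    qed
    have f1: "fam 1 Q T {l. E l m} (card S + 1)" if mN: "m \<in> N1" for m
    proof -
      obtain t where t: "t \<in> T" "E t m" using mN unfolding N1_def by blast
      have "fam 1 Q T {t} (card S + 1)"
        unfolding Q_def using finS ST card t(1) by (intro biclique_fam) auto
      then show ?thesis
        using fam_mono[of 1 Q T "{t}" "card S + 1"] t(2) by auto
    qed
    have "\<exists>a. fam a D M L k"
      by (rule join[OF a1 _ _ _ f1]) (auto simp: j_def)
    then show ?thesis ..
  next
    case 2
    \<comment> \<open>With its end in \<open>S\<close>, the core offers only \<open>card S\<close>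
      lengths, so the bound may drop by at most \<open>card S - 1\<close>. Neighbours of
      \<open>S\<close> lose at most \<open>card S\<close> and regain one; the other vertices can
      lose only x, which is affordable because \<open>2 \<le> card S\<close>.\<close>
    define j where "j = max 1 (k + 1 - card S)"
    have a2: "adm G N2 L' j"
    proof (rule admG[OF _ 2(2)])
      show "N2 \<subseteq> G" unfolding N2_def by blast
      show "monochromatic N2" using colS bip unfolding N2_def monochromatic_def by blast
      fix v assume v: "v \<in> G"
      have "{t \<in> T. E v t} = {}" using v sym 2(1) unfolding N1_def by blast
      then have nT: "card {t \<in> T. E v t} = 0" by (simp only: card.empty)
      show "j \<le> 1 \<or> j + c v \<le> k + of_bool (v \<in> N2)"
      proof (cases "v \<in> N2")
        case True
        have "card {u \<in> S. E v u} + of_bool (v \<in> M) \<le> card S"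
          using v GD by (intro beta) blast
        then have "c v \<le> card S"
          using nT unfolding c_def by simp
        then show ?thesis using True unfolding j_def by auto
      next
        case False
        then have "{u \<in> S. E v u} = {}" using v sym unfolding N2_def by blast
        then have "card {u \<in> S. E v u} = 0" by (simp only: card.empty)
        then have "c v \<le> 1"
          using nT unfolding c_def by simp
        then show ?thesis using 2(3) unfolding j_def by auto
      qed
    qed
    have f2: "fam 2 Q T {l. E l m} (card S)" if mN: "m \<in> N2" for m
    proof -
      obtain u where u: "u \<in> S" "E u m" using mN unfolding N2_def by blast
      have "fam 2 Q T {u} (card S)"
        unfolding Q_def using finS ST card u(1) by (intro biclique_fam') auto
      then show ?thesis
        using fam_mono[of 2 Q T "{u}" "card S"] u(2) by auto
    qed
    have "\<exists>a. fam a D M L k"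
      by (rule join[OF a2 _ _ _ f2]) (use 2(3) in \<open>auto simp: j_def\<close>)
    then show ?thesis ..
  next
    case 3
    have T0: "nb D G \<inter> T = {}"
      using 3(1) sym unfolding N1_def nb_def by blast
    have "card (nb D G \<inter> S) \<le> 1"
    proof (cases "N2 = {}")
      case True
      then have "nb D G \<inter> S = {}" using sym unfolding N2_def nb_def by blast
      then show ?thesis by simp
    next
      case False
      then have "card S \<le> 1" using 3(2) by blast
      then show ?thesis
        using card_mono[OF finS(1), of "nb D G \<inter> S"] by auto
    qed
    moreover have "nb D G \<subseteq> nb A G \<union> (nb D G \<inter> S)"
      using nbA[OF G(1)] T0 unfolding Q_def by auto
    then have "card (nb D G) \<le> card (nb A G \<union> (nb D G \<inter> S))"
      using finite_nb[OF finA] finS by (intro card_mono) auto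
    moreover have "\<dots> \<le> card (nb A G) + card (nb D G \<inter> S)"
      by (rule card_Un_le)
    ultimately have "card (nb D G) + of_bool (G \<inter> L \<noteq> {}) \<le> 2"
      using G(3) unfolding w_def by linarith
    then show ?thesis
      using G(2) GD T0 by blast
  qed
qed

section \<open>Pieces with three neighbours\<close>

lemma reach_sym:
  assumes "z \<in> reach U {x}" "z \<in> reach U {y}"
  shows "x \<in> reach U {y}"
proof -
  obtain p where p: "path p" "set p \<subseteq> reach U {x}" "hd p = x" "last p = z"
    using reachE[OF assms(1)] by blast
  have pn: "p \<noteq> []" using p(1) by (rule path_nonempty)
  have "set (rev p) \<subseteq> reach U {y}"
  proof (rule reach_path)
    show "path (rev p)" using p(1) by (simp add: path_rev)
    show "hd (rev p) \<in> reach U {y}" using p(4) pn assms(2) by (simp add: hd_rev)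
    show "set (rev p) \<subseteq> U" using p(2) reach_subset[of U "{x}"] by auto
  qed
  then show ?thesis using p(3) pn hd_in_set[of p] by auto
qed

lemma ear_in_component:
  assumes "K = reach U {r}" "2 \<le> card (K \<inter> L)"
  shows "\<exists>C. ear U L C"
proof -
  have "\<exists>l1 l2. l1 \<in> K \<inter> L \<and> l2 \<in> K \<inter> L \<and> l1 \<noteq> l2"
    using assms(2) by (metis One_nat_def Suc_1 card_le_Suc0_iff_eq card.infinite not_less_eq_eq zero_le)
  then obtain l1 l2 where l: "l1 \<in> K" "l1 \<in> L" "l2 \<in> K" "l2 \<in> L" "l1 \<noteq> l2" by blast
  obtain p where p: "path p" "set p \<subseteq> K" "hd p = l1" "last p = l2"
    using reach_connected[of l1 U r l2] l assms(1) by blast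
  have "2 \<le> length p"
    using p l(5) path_nonempty[OF p(1)] by (cases p; cases "tl p") auto
  then have "ear U L p"
    unfolding ear_def using p l reach_subset[of U "{r}"] assms(1) by auto
  then show ?thesis ..
qed

text \<open>If y had a single neighbour, this vertex and x would separate the rest of
  \<open>D\<close>, against \<open>c3\<close>. If there is no rest, the only vertex has degree at
  most 2.\<close>

lemma two_exits:
  assumes adm: "adm D M L k" and k: "2 \<le> k"
    and c3: "\<And>F. F \<subseteq> D \<Longrightarrow> F \<noteq> {} \<Longrightarrow> F \<noteq> D \<Longrightarrow> 3 \<le> cut D M L F"
  shows "2 \<le> card L"
proof (rule ccontr)
  assume c: "\<not> 2 \<le> card L"
  have D: "finite D" "D \<noteq> {}" "L \<subseteq> D" using adm unfolding adm_def by auto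
  have finL: "finite L" using D finite_subset by blast
  have "2 \<le> cut D M L D" using adm unfolding adm_def by auto
  then have "L \<noteq> {}"
    unfolding cut_def nb_def by (auto simp: of_bool_def split: if_splits)
  show False
  proof (cases "D - L = {}")
    case True
    then have "card D \<le> 1" using c D(3) by (simp add: subset_antisym)
    moreover have "card D \<noteq> 0" using D by simp
    ultimately have "card D = 1" by linarith
    then obtain v where "D = {v}" by (auto simp: card_1_singleton_iff)
    moreover have "k + 1 \<le> cut D M L {v}"
      using adm \<open>D = {v}\<close> unfolding adm_def by auto
    moreover have "nb D {v} = {}"
      using \<open>D = {v}\<close> by (auto simp: nb_def)
    ultimately show False
      using k unfolding cut_def by (simp add: of_bool_def split: if_splits)
  next
    case False
    have "nb D (D - L) \<subseteq> L" unfolding nb_def by auto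
    then have "card (nb D (D - L)) \<le> card L"
      by (rule card_mono[OF finL])
    then have "card (nb D (D - L)) \<le> 1"
      using c by linarith
    moreover have "3 \<le> cut D M L (D - L)"
      using c3[of "D - L"] False \<open>L \<noteq> {}\<close> D(3) by blast
    moreover have "(D - L) \<inter> L = {}" by blast
    ultimately show False
      unfolding cut_def by (simp add: of_bool_def split: if_splits)
  qed
qed

text \<open>
  A set \<open>G\<close> with three neighbours \<open>x\<close>, \<open>p\<close>, \<open>q\<close>: ignoring \<open>q\<close> costs one unit of degree, so there are
  \<open>k - 1\<close> lengths from \<open>x\<close> to \<open>p\<close> inside \<open>G\<close>. The missing length comes from a lollipop
  outside \<open>G\<close>, or from a second piece that itself carries \<open>k - 1 \<ge> 2\<close> lengths.
\<close>

lemma bad_piece: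
  assumes adm: "adm D M L k" and k: "3 \<le> k"
    and IH: "\<And>D' M' L' k'. adm D' M' L' k' \<Longrightarrow> card D' < card D \<Longrightarrow> \<exists>a. fam a D' M' L' k'"
    and c3: "\<And>F. F \<subseteq> D \<Longrightarrow> F \<noteq> {} \<Longrightarrow> F \<noteq> D \<Longrightarrow> 3 \<le> cut D M L F"
    and G: "G \<subseteq> D" "G \<noteq> {}" "card (nb D G) + of_bool (G \<inter> L \<noteq> {}) \<le> 2"
    and r: "r \<in> D" "r \<notin> G" "r \<notin> nb D G"
  shows "\<exists>a. fam a D M L k"
proof -
  have D: "finite D" "M \<subseteq> D" "L \<subseteq> D" "monochromatic M" "monochromatic L"
    and cutk: "\<And>v. v \<in> D \<Longrightarrow> k + 1 \<le> cut D M L {v}"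
    using adm unfolding adm_def by auto
  define U where "U = D - G"
  define A where "A = nb D G"
  define L' where "L' = L \<inter> U"
  have AU: "A \<subseteq> U" unfolding A_def U_def nb_def by auto
  have finU: "finite U" "finite A" using D(1) finite_nb unfolding U_def A_def by auto
  have GD: "G \<noteq> D" using r by blast
  have "3 \<le> cut D M L G" using c3 G GD by blast
  then have GM: "G \<inter> M \<noteq> {}" and two: "card A + of_bool (G \<inter> L \<noteq> {}) = 2"
    using G(3) unfolding cut_def A_def by (auto simp: of_bool_def split: if_splits)
  have noG: "E f z \<Longrightarrow> f \<in> U - A \<Longrightarrow> z \<notin> G" for f z
    using sym unfolding U_def A_def nb_def by blast
  have famG: "\<exists>a. fam a G (G \<inter> M) {l. E l p} (k - 1)" if p: "p \<in> A" for p
  proof -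
    have cle: "cut D M L F \<le> cut G (G \<inter> M) (G \<inter> {l. E l p}) F + 1" if F: "F \<subseteq> G" for F
    proof -
      define X where "X = {z \<in> A. \<exists>v\<in>F. E v z}"
      have XA: "X \<subseteq> A" "finite X" using finU unfolding X_def by auto
      have "nb D F \<subseteq> nb G F \<union> X"
        using F unfolding X_def A_def nb_def by blast
      moreover have "card X + of_bool (F \<inter> M \<noteq> {}) + of_bool (F \<inter> L \<noteq> {})
        \<le> of_bool (F \<inter> (G \<inter> M) \<noteq> {}) + of_bool (F \<inter> (G \<inter> {l. E l p}) \<noteq> {}) + 1"
      proof -
        have "card (X - {p}) \<le> card (A - {p})" using XA finU by (intro card_mono) auto
        moreover have "card (A - {p}) + 1 = card A" using card_Suc_Diff1[OF finU(2) p] by (metis Suc_eq_plus1)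
        moreover have "card X \<le> card (X - {p}) + of_bool (p \<in> X)"
          using XA(2) by (cases "p \<in> X") auto
        moreover have "of_bool (F \<inter> L \<noteq> {}) \<le> (of_bool (G \<inter> L \<noteq> {}) :: nat)"
          using F by (auto simp: of_bool_def)
        moreover have "of_bool (p \<in> X) \<le> (of_bool (F \<inter> (G \<inter> {l. E l p}) \<noteq> {}) :: nat)"
          using F unfolding X_def by (auto simp: of_bool_def)
        moreover have "F \<inter> (G \<inter> M) = F \<inter> M" using F by blast
        then have "of_bool (F \<inter> (G \<inter> M) \<noteq> {}) = (of_bool (F \<inter> M \<noteq> {}) :: nat)" by (simp only:)
        ultimately show ?thesis using two by linarith
      qed
      moreover have "finite G" using G(1) D(1) finite_subset by blast
      ultimately show ?thesis using XA(2) by (intro cut_compare)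
    qed
    have "adm G (G \<inter> M) (G \<inter> {l. E l p}) (k - 1)"
      unfolding adm_def
    proof (intro conjI ballI allI impI)
      show "finite G" using G(1) D(1) finite_subset by blast
      show "monochromatic (G \<inter> M)" "monochromatic (G \<inter> {l. E l p})"
        using D(4) monochromatic_Int monochromatic_nbrs(2) by blast+
      fix v assume v: "v \<in> G"
      then have "{v} \<subseteq> G" "v \<in> D" using G(1) by auto
      then show "k - 1 + 1 \<le> cut G (G \<inter> M) (G \<inter> {l. E l p}) {v}"
        using cle[of "{v}"] cutk[of v] k by linarith
    next
      fix F assume F: "F \<subseteq> G" "F \<noteq> {}"
      then have "3 \<le> cut D M L F" using c3[of F] G(1) GD by blast
      then show "2 \<le> cut G (G \<inter> M) (G \<inter> {l. E l p}) F"
        using cle[OF F(1)] by linarith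
    qed (use G in auto)
    moreover have "card G < card D"
      using G(1) GD D(1) by (intro psubset_card_mono) auto
    ultimately obtain a where "fam a G (G \<inter> M) (G \<inter> {l. E l p}) (k - 1)"
      using IH by blast
    then show ?thesis
      using fam_mono[of a G "G \<inter> M" "G \<inter> {l. E l p}" "k - 1" "k - 1" G "G \<inter> M" "{l. E l p}"] by blast
  qed
  have conn: "nb U F \<noteq> {}" if F: "F \<subseteq> U" "F \<noteq> {}" "F \<inter> A = {}" for F
  proof
    assume n: "nb U F = {}"
    have "nb D F = {}"
    proof (rule ccontr)
      assume "nb D F \<noteq> {}"
      then obtain z f where "f \<in> F" "E f z" "z \<in> D - F" unfolding nb_def by blast
      then show False using n noG[of f z] F unfolding nb_def U_def by blast
    qed
    moreover have "3 \<le> cut D M L F"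
      using c3[of F] F G unfolding U_def by blast
    ultimately show False unfolding cut_def by (simp add: of_bool_def split: if_splits)
  qed
  have "(\<exists>C. ear U L' C) \<or> fcase U A L'"
  proof -
    define K where "K = reach U {r}"
    have KU: "K \<subseteq> U" unfolding K_def by (rule reach_subset)
    have rK: "r \<in> K" unfolding K_def U_def using r by (intro reach_base) auto
    have Kc: "f \<in> K \<Longrightarrow> E f z \<Longrightarrow> z \<in> U \<Longrightarrow> z \<in> K" for f z
      unfolding K_def by (rule reach_closed)
    have finK: "finite K" using KU finU finite_subset by blast
    show ?thesis
    proof (cases "2 \<le> card (K \<inter> L')")
      case True
      then show ?thesis using ear_in_component[OF K_def] by blast
    next
      case K1: False
      have KL: "K \<inter> L' = K \<inter> L" using KU unfolding L'_def by blast
      \<comment> \<open>If \<open>K\<close> contains at most one vertex of \<open>A\<close>, a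
        nonempty \<open>F\<close> has at most two neighbours in \<open>D\<close>. By
        \<open>c3\<close> it has exactly two, and they serve as one-vertex paths \<open>w1\<close>
        and \<open>w2\<close>. An empty \<open>F\<close> would force the degree of \<open>r\<close>
        down to 3.\<close>
      define F where "F = K - A - L"
      have nbF: "nb D F \<subseteq> (K \<inter> A) \<union> (K \<inter> L)"
      proof
        fix z assume "z \<in> nb D F"
        then obtain f where f: "f \<in> F" "E f z" "z \<in> D - F" unfolding nb_def by auto
        then have "z \<in> U" using noG[of f z] KU unfolding F_def U_def by auto
        then have "z \<in> K" using Kc f unfolding F_def by blast
        then show "z \<in> (K \<inter> A) \<union> (K \<inter> L)" using f(3) unfolding F_def by blast
      qed
      have FD: "F \<subseteq> D" "F \<noteq> D" using KU G unfolding F_def U_def by auto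
      have FL: "F \<inter> L = {}" unfolding F_def by auto
      show ?thesis
      proof (cases "card (K \<inter> A) \<le> 1")
        case A1: True
        have cU: "card ((K \<inter> A) \<union> (K \<inter> L)) \<le> card (K \<inter> A) + card (K \<inter> L)" by (rule card_Un_le)
        have L1: "card (K \<inter> L) \<le> 1" using K1 KL by simp
        show ?thesis
        proof (cases "F = {}")
          case True
          then have rL: "r \<in> K \<inter> L" using rK r(3) unfolding F_def A_def by blast
          have "K \<inter> L = {r}"
            using L1 rL finK card_seteq[of "K \<inter> L" "{r}"] by auto
          then have "nb D {r} \<subseteq> K \<inter> A"
            using True Kc[OF rK] noG[of r] KU rK r(3) unfolding F_def nb_def U_def A_def by blast
          then have "card (nb D {r}) \<le> 1"
            using A1 finK card_mono[of "K \<inter> A" "nb D {r}"] by auto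
          then have "cut D M L {r} \<le> 3" unfolding cut_def by (auto simp: of_bool_def)
          then show ?thesis using cutk[OF r(1)] k by simp
        next
          case False
          have "3 \<le> cut D M L F" using c3 FD False by blast
          then have c2: "2 \<le> card (nb D F)"
            using FL unfolding cut_def by (auto simp: of_bool_def split: if_splits)
          moreover have le: "card (nb D F) \<le> card ((K \<inter> A) \<union> (K \<inter> L))"
            using nbF finK by (intro card_mono) auto
          ultimately have one: "card (K \<inter> A) = 1" "card (K \<inter> L) = 1" "card ((K \<inter> A) \<union> (K \<inter> L)) = 2"
            using cU A1 L1 by linarith+
          obtain p u where pu: "K \<inter> A = {p}" "K \<inter> L = {u}"
            using one(1,2) by (auto simp: card_1_singleton_iff)
          have "p \<noteq> u" using one(3) pu by auto
          then have "fcase U A L'"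
            unfolding fcase_def using False pu nbF FL KU KL
            by (intro exI[of _ F] exI[of _ "[p]"] exI[of _ "[u]"])
              (auto simp: path_sing F_def L'_def nb_def U_def)
          then show ?thesis ..
        qed
      next
        case False
        then have "2 \<le> card (K \<inter> A)" by simp
        moreover have "card A \<le> 2" using two by simp
        ultimately have AK: "K \<inter> A = A" and GL: "G \<inter> L = {}"
          using card_seteq[of A "K \<inter> A"] finU two card_mono[of A "K \<inter> A"]
          by (auto simp: of_bool_def split: if_splits)
        \<comment> \<open>Here \<open>K\<close> contains all of \<open>A\<close>. Some neighbour of
          y is outside \<open>K\<close>, and its component in \<open>U\<close> avoids
          \<open>A\<close>, which \<open>conn\<close> forbids.\<close>
        have "2 \<le> card L" using two_exits[OF adm _ c3] k by simp
        moreover have "card (K \<inter> L) \<le> 1" using K1 KL by simp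
        ultimately have "\<not> L \<subseteq> K" by (metis Int_absorb1 le_trans not_less_eq_eq numeral_2_eq_2 One_nat_def)
        then obtain l where l: "l \<in> L" "l \<notin> K" by blast
        then have lU: "l \<in> U" using GL D(3) unfolding U_def by blast
        have "reach U {l} \<inter> A = {}"
          using reach_sym[of _ U l r] AK l(2) unfolding K_def by blast
        moreover have "l \<in> reach U {l}" using lU reach_base by blast
        ultimately show ?thesis
          using conn[of "reach U {l}"] reach_nb[of U "{l}"] reach_subset[of U "{l}"] by blast
      qed
    qed
  qed
  moreover have "monochromatic L'" unfolding L'_def using monochromatic_subset[OF D(5)] by blast
  ultimately consider "\<exists>p\<in>A. \<exists>a. fam a U {p} L' 2" | "fcase U A L'"
    using lollipop[OF finU(1) _ conn] by blast
  then show ?thesis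
  proof cases
    case 1
    then obtain p b where p: "p \<in> A" "fam b U {p} L' 2" by blast
    obtain a where a: "fam a G (G \<inter> M) {l. E l p} (k - 1)" using famG[OF p(1)] by blast
    have "fam (a + b) (G \<union> U) (G \<inter> M) L' k"
    proof (rule fam_concat[OF _ p(2)])
      show "G \<inter> U = {}" unfolding U_def by blast
    qed (use a k in auto)
    then show ?thesis
      using fam_mono[of "a + b" "G \<union> U" "G \<inter> M" L' k k D M L] G(1) unfolding U_def L'_def by blast
  next
    case 2
    then obtain F w1 w2 where F: "F \<noteq> {}" "F \<subseteq> U - A" "path w1" "set w1 \<subseteq> U - F" "hd w1 \<in> A"
      "nb U F \<subseteq> {last w1} \<union> (if w2 = [] then {} else {hd w2})"
      and w2: "w2 \<noteq> [] \<Longrightarrow> path w2 \<and> set w2 \<subseteq> U - F \<and> set w1 \<inter> set w2 = {} \<and> last w2 \<in> L' \<and> F \<inter> L' = {}"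
      unfolding fcase_def by auto
    define x where "x = last w1"
    define M1 where "M1 = F \<inter> {u. E x u}"
    define L1 where "L1 = (if w2 = [] then F \<inter> L else F \<inter> {u. E u (hd w2)})"
    have finF: "finite F" using F(2) finU finite_subset by blast
    have FD: "F \<subseteq> D" "F \<noteq> D" using F(2) G unfolding U_def by auto
    have FL: "w2 \<noteq> [] \<Longrightarrow> F \<inter> L = {}" using w2 F(2) unfolding L'_def by blast
    obtain a where a: "fam a G (G \<inter> M) {l. E l (hd w1)} (k - 1)" using famG[OF F(5)] by blast
    have f1: "fam (a + length w1) (G \<union> set w1) (G \<inter> M) {x} (k - 1)"
      unfolding x_def
    proof (rule fam_concat[OF _ fam_path[OF F(3)]])
      show "G \<inter> set w1 = {}" using F(4) unfolding U_def by blast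
    qed (use a k in auto)
    \<comment> \<open>Only the adjacency to the old root with neighbourhood \<open>M\<close> is
      lost; the boundary vertices \<open>x\<close> and \<open>hd w2\<close>, or y in place of the
      latter, act as the new roots.\<close>
    have cle: "cut D M L F' \<le> cut F M1 L1 F' + 1" if F': "F' \<subseteq> F" for F'
    proof -
      define X1 where "X1 = (if F' \<inter> M1 \<noteq> {} then {x} else {})"
      define X3 where "X3 = (if w2 \<noteq> [] \<and> F' \<inter> L1 \<noteq> {} then {hd w2} else {})"
      have "nb D F' \<subseteq> nb F F' \<union> (X1 \<union> X3)"
      proof
        fix z assume z: "z \<in> nb D F'"
        then obtain v where v: "v \<in> F'" "E v z" "z \<in> D - F'"
          unfolding nb_def by auto
        show "z \<in> nb F F' \<union> (X1 \<union> X3)"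
        proof (cases "z \<in> F")
          case True
          then show ?thesis using v unfolding nb_def by auto
        next
          case False
          have "z \<notin> G" using noG[of v z] v F' F(2) by blast
          then have "z \<in> nb U F"
            using v F' False unfolding nb_def U_def by auto
          then have "z = x \<or> w2 \<noteq> [] \<and> z = hd w2"
            using F(6) unfolding x_def by (auto split: if_splits)
          then show ?thesis
            using v F' sym unfolding X1_def X3_def M1_def L1_def by auto
        qed
      qed
      moreover have "card X1 \<le> (of_bool (F' \<inter> M1 \<noteq> {}) :: nat)"
        unfolding X1_def by (auto simp: of_bool_def)
      moreover have "card X3 + of_bool (F' \<inter> L \<noteq> {}) \<le> (of_bool (F' \<inter> L1 \<noteq> {}) :: nat)"
        using FL F' unfolding X3_def L1_def by (auto simp: of_bool_def)
      moreover have "card (X1 \<union> X3) \<le> card X1 + card X3"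
        by (rule card_Un_le)
      moreover have "finite (X1 \<union> X3)"
        unfolding X1_def X3_def by auto
      moreover have "of_bool (F' \<inter> M \<noteq> {}) \<le> (1::nat)" by simp
      ultimately show ?thesis
        using cut_compare[of F "X1 \<union> X3" D F' M L M1 L1 1] finF by linarith
    qed
    have "adm F M1 L1 (k - 1)"
      unfolding adm_def
    proof (intro conjI ballI allI impI)
      show "monochromatic M1" unfolding M1_def by (simp add: monochromatic_Int monochromatic_nbrs)
      show "monochromatic L1" unfolding L1_def by (simp add: monochromatic_Int D(5) monochromatic_nbrs)
      show "M1 \<subseteq> F" "L1 \<subseteq> F" unfolding M1_def L1_def by auto
      fix v assume v: "v \<in> F"
      then have "{v} \<subseteq> F" "v \<in> D" using FD(1) by auto
      then show "k - 1 + 1 \<le> cut F M1 L1 {v}"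
        using cle[of "{v}"] cutk[of v] k by linarith
    next
      fix F' assume F': "F' \<subseteq> F" "F' \<noteq> {}"
      then have "3 \<le> cut D M L F'" using c3[of F'] FD by blast
      then show "2 \<le> cut F M1 L1 F'"
        using cle[OF F'(1)] by linarith
    qed (use F finF in auto)
    moreover have "card F < card D"
      using FD D(1) by (intro psubset_card_mono) auto
    ultimately obtain b where b: "fam b F M1 L1 (k - 1)" using IH by blast
    have f2: "fam (a + length w1 + b) ((G \<union> set w1) \<union> F) (G \<inter> M) L1 k"
    proof (rule fam_concat[OF _ b])
      fix m assume "m \<in> M1"
      then have "{x} \<subseteq> {l. E l m}" unfolding M1_def by auto
      then show "fam (a + length w1) (G \<union> set w1) (G \<inter> M) {l. E l m} (k - 1)"
        using fam_mono[OF f1 order_refl order_refl order_refl] by blast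
    next
      show "(G \<union> set w1) \<inter> F = {}" using F(2,4) unfolding U_def by blast
    qed (use k in auto)
    show ?thesis
    proof (cases "w2 = []")
      case True
      then show ?thesis
        using fam_mono[OF f2, of k D M L] G(1) F(4) FD(1) unfolding L1_def U_def by auto
    next
      case False
      note w = w2[OF False]
      have "fam (a + length w1 + b + length w2) (((G \<union> set w1) \<union> F) \<union> set w2) (G \<inter> M) {last w2} k"
      proof (rule fam_concat[OF _ fam_path])
        show "path w2" using w by blast
      next
        fix m assume "m \<in> {hd w2}"
        then have "L1 \<subseteq> {l. E l m}" using False unfolding L1_def by auto
        then show "fam (a + length w1 + b) (G \<union> set w1 \<union> F) (G \<inter> M) {l. E l m} k"
          using fam_mono[OF f2 order_refl order_refl order_refl] by blast
      next
        show "(G \<union> set w1 \<union> F) \<inter> set w2 = {}"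
          using w unfolding U_def by blast
      qed (use k in auto)
      moreover have "((G \<union> set w1) \<union> F) \<union> set w2 \<subseteq> D"
        using w G(1) F(4) FD(1) unfolding U_def by blast
      moreover have "{last w2} \<subseteq> L" using w unfolding L'_def by blast
      ultimately show ?thesis
        using fam_mono[of _ _ "G \<inter> M" "{last w2}" k k D M L] by blast
    qed
  qed
qed

section \<open>The induction on rooted graphs\<close>

lemma adm_swap: "adm D M L k \<Longrightarrow> adm D L M k"
  unfolding adm_def cut_def by (auto simp: add.commute add.left_commute)

lemma adm_nonempty:
  assumes "adm D M L k"
  shows "M \<noteq> {}" "L \<noteq> {}"
proof -
  have "2 \<le> cut D M L D" using assms unfolding adm_def by auto
  then show "M \<noteq> {}" "L \<noteq> {}"
    unfolding cut_def nb_def by (auto simp: of_bool_def split: if_splits)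
qed

text \<open>
  A maximal core for which \<open>core_step\<close> is not applicable because all neighbours of \<open>y\<close> lie in it.
\<close>

definition absorbing_core :: "'a set \<Rightarrow> 'a set \<Rightarrow> 'a set \<Rightarrow> 'a set \<Rightarrow> 'a set \<Rightarrow> bool" where
  "absorbing_core D M L S T \<longleftrightarrow> S \<subseteq> D \<and> T \<subseteq> M \<and> (\<forall>u\<in>S. \<forall>t\<in>T. E u t) \<and> card S < card T
    \<and> L \<subseteq> S \<union> T \<and> (\<forall>v\<in>D - (S \<union> T). card {t \<in> T. E v t} \<le> card S + 1)"

text \<open>\<open>T S\<close> consists of the common neighbours of \<open>S\<close> and x. Let
  \<open>S\<close> be as large as possible with \<open>card S < card (T S)\<close>. A vertex with
  \<open>card S + 2\<close> neighbours in \<open>T S\<close> could be added to \<open>S\<close>, and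
  a vertex of \<open>M\<close> outside \<open>T S\<close> misses some vertex of \<open>S\<close>;
  these are the two bounds that \<open>core_step\<close> asks for. A bad piece and its neighbours
  avoid \<open>T S\<close>, so any vertex of \<open>T S\<close> can be the \<open>r\<close> of
  \<open>bad_piece\<close>.\<close>

lemma core_exists:
  assumes adm: "adm D M L k" and k: "3 \<le> k"
    and IH: "\<And>D' M' L' k'. adm D' M' L' k' \<Longrightarrow> card D' < card D \<Longrightarrow> \<exists>a. fam a D' M' L' k'"
    and c3: "\<And>F. F \<subseteq> D \<Longrightarrow> F \<noteq> {} \<Longrightarrow> F \<noteq> D \<Longrightarrow> 3 \<le> cut D M L F"
  shows "(\<exists>a. fam a D M L k) \<or> (\<exists>S T. absorbing_core D M L S T)"
proof -
  have D: "finite D" "M \<subseteq> D" "L \<subseteq> D" "monochromatic M" "monochromatic L"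
    and cutk: "\<And>v. v \<in> D \<Longrightarrow> k + 1 \<le> cut D M L {v}"
    using adm unfolding adm_def by auto
  define T where "T S = {m \<in> M. \<forall>u\<in>S. E u m}" for S
  have finM: "finite M" using D finite_subset by blast
  have finT: "finite (T S)" for S using finM unfolding T_def by auto
  have core0: "{} \<subseteq> D \<and> card {} < card (T {})"
    using adm_nonempty(1)[OF adm] finM unfolding T_def by (simp add: card_gt_0_iff)
  obtain S where S: "S \<subseteq> D" "card S < card (T S)"
    and Smax: "\<And>S'. S' \<subseteq> D \<Longrightarrow> card S' < card (T S') \<Longrightarrow> card S' \<le> card S"
    using ex_has_greatest_nat[of "\<lambda>S. S \<subseteq> D \<and> card S < card (T S)" "{}" card "card D + 1"]
      core0 card_mono[OF D(1)] by (metis (no_types, lifting) Suc_eq_plus1 le_imp_less_Suc less_imp_le)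
  have finS: "finite S" using S D finite_subset by blast
  have TM: "T S \<subseteq> M" unfolding T_def by auto
  have alpha: "card {t \<in> T S. E v t} \<le> card S + 1" if v: "v \<in> D - (S \<union> T S)" for v
  proof (rule ccontr)
    assume c: "\<not> ?thesis"
    have "T (insert v S) = {t \<in> T S. E v t}" unfolding T_def by auto
    moreover have "card (insert v S) = card S + 1" using v finS by simp
    ultimately show False
      using Smax[of "insert v S"] c v S(1) by simp
  qed
  have beta: "card {u \<in> S. E v u} + of_bool (v \<in> M) \<le> card S" if v: "v \<in> D - (S \<union> T S)" for v
  proof (cases "v \<in> M")
    case True
    then have "{u \<in> S. E v u} \<subset> S"
      using v sym unfolding T_def by blast
    then have "card {u \<in> S. E v u} < card S" using finS psubset_card_mono by blast
    then show ?thesis by (simp add: of_bool_def)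
  next
    case False
    then show ?thesis using card_mono[OF finS, of "{u \<in> S. E v u}"] by auto
  qed
  show ?thesis
  proof (cases "L - (S \<union> T S) = {}")
    case True
    then have LST: "L \<subseteq> S \<union> T S" by blast
    have "\<forall>u\<in>S. \<forall>t\<in>T S. E u t" unfolding T_def by blast
    then have "absorbing_core D M L S (T S)"
      unfolding absorbing_core_def using S TM alpha LST by simp
    then show ?thesis by blast
  next
    case False
    have "(\<exists>a. fam a D M L k) \<or>
      (\<exists>G. G \<noteq> {} \<and> G \<subseteq> D - (S \<union> T S) \<and> nb D G \<inter> T S = {} \<and> card (nb D G) + of_bool (G \<inter> L \<noteq> {}) \<le> 2)"
    proof (rule core_step[OF D IH S(1) TM _ S(2) alpha beta _ False])
      show "E u t" if "u \<in> S" "t \<in> T S" for u t using that unfolding T_def by auto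
      show "k + 1 \<le> cut D M L {v}" if "v \<in> D - (S \<union> T S)" for v using cutk that by blast
    qed
    moreover have "\<exists>a. fam a D M L k"
      if G: "G \<noteq> {}" "G \<subseteq> D - (S \<union> T S)" "nb D G \<inter> T S = {}" "card (nb D G) + of_bool (G \<inter> L \<noteq> {}) \<le> 2" for G
    proof -
      obtain r where r: "r \<in> T S" using S(2) by fastforce
      then have "r \<in> D" "r \<notin> G" "r \<notin> nb D G" using TM D(2) G(2,3) by auto
      then show ?thesis
        using bad_piece[OF adm k IH c3, of G r] G by blast
    qed
    ultimately show ?thesis by blast
  qed
qed

lemma adm_fam: "adm D M L k \<Longrightarrow> \<exists>a. fam a D M L k"
proof (induction "card D" arbitrary: D M L k rule: less_induct)
  case less
  note adm = less.prems
  have IH: "adm D' M' L' k' \<Longrightarrow> card D' < card D \<Longrightarrow> \<exists>a. fam a D' M' L' k'" for D' M' L' k'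
    using less.hyps by blast
  have D: "finite D" "M \<subseteq> D" "L \<subseteq> D" "monochromatic M" "monochromatic L" "D \<noteq> {}"
    and cutk: "\<And>v. v \<in> D \<Longrightarrow> k + 1 \<le> cut D M L {v}"
    and cut2: "\<And>F. F \<subseteq> D \<Longrightarrow> F \<noteq> {} \<Longrightarrow> 2 \<le> cut D M L F"
    using adm unfolding adm_def by auto
  show ?case
  proof (cases "\<exists>F. F \<subseteq> D \<and> F \<noteq> {} \<and> F \<noteq> D \<and> cut D M L F \<le> 2")
    case True
    then obtain F where F: "F \<subseteq> D" "F \<noteq> {}" "F \<noteq> D" "cut D M L F \<le> 2" by blast
    show ?thesis by (rule reduce_two_cut[OF adm IH F])
  next
    case False
    have c3: "3 \<le> cut D M L F" if F: "F \<subseteq> D" "F \<noteq> {}" "F \<noteq> D" for F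
    proof (rule ccontr)
      assume "\<not> ?thesis"
      then have "cut D M L F \<le> 2" by simp
      then show False using False F by blast
    qed
    consider "k \<le> 1" | "k = 2" | "3 \<le> k" by linarith
    then show ?thesis
    proof cases
      case 1
      obtain v where "v \<in> D" using D(6) by blast
      then obtain p where p: "path p" "set p \<subseteq> D" "hd p \<in> M" "last p \<in> L"
        using on_path[OF D(1-3) cut2] by metis
      then have "fam (length p) D M L k"
        using fam_mono[OF fam_path[OF p(1)] 1, of D M L] by blast
      then show ?thesis by blast
    next
      case 2
      obtain v where v: "v \<in> D" using D(6) by blast
      define K where "K = reach D {v}"
      have "K = D"
      proof (rule ccontr)
        assume "K \<noteq> D"
        moreover have "K \<subseteq> D" "v \<in> K" "nb D K = {}"
          unfolding K_def using reach_subset reach_base[of v "{v}" D] v reach_nb by auto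
        ultimately have "3 \<le> cut D M L K" using c3[of K] by blast
        then show False
          unfolding cut_def using \<open>nb D K = {}\<close> by (simp add: of_bool_def split: if_splits)
      qed
      moreover have "2 \<le> card L" using two_exits[OF adm _ c3] 2 by simp
      ultimately have ex: "\<exists>C. ear D L C"
        using ear_in_component[OF K_def, of L] D(3) by (simp add: Int_absorb1)
      have conn: "nb D F \<noteq> {}" if F: "F \<subseteq> D" "F \<noteq> {}" "F \<inter> M = {}" for F
        using cut2[OF F(1,2)] F(3) unfolding cut_def by (auto simp: of_bool_def split: if_splits)
      \<comment> \<open>Such a set would avoid \<open>M\<close> and have at most two neighbours, y
        included, against \<open>c3\<close>.\<close>
      have "\<not> fcase D M L"
      proof
        assume "fcase D M L"
        then obtain F w1 w2 where F: "F \<noteq> {}" "F \<subseteq> D - M" "path w1" "set w1 \<subseteq> D - F"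
          "nb D F \<subseteq> {last w1} \<union> (if w2 = [] then {} else {hd w2})"
          "w2 \<noteq> [] \<Longrightarrow> F \<inter> L = {}"
          unfolding fcase_def by auto
        have "last w1 \<in> D - F" using F(4) path_nonempty[OF F(3)] last_in_set by blast
        then have "3 \<le> cut D M L F" using c3[of F] F(1,2) by blast
        moreover have "F \<inter> M = {}" using F(2) by blast
        moreover have "card (nb D F) + of_bool (F \<inter> L \<noteq> {}) \<le> 2"
        proof (cases "w2 = []")
          case True
          then have "card (nb D F) \<le> 1"
            using F(5) card_mono[of "{last w1}" "nb D F"] by simp
          then show ?thesis by (simp add: of_bool_def)
        next
          case False
          then have "card (nb D F) \<le> card {last w1, hd w2}"
            using F(5) by (intro card_mono) auto
          also have "\<dots> \<le> 2" by (simp add: card_insert_if)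
          finally show ?thesis using F(6)[OF False] by simp
        qed
        ultimately show False unfolding cut_def by simp
      qed
      then obtain p a where "p \<in> M" "fam a D {p} L 2"
        using lollipop[OF D(1,5) conn ex] by blast
      then have "fam a D M L 2"
        using fam_mono[of a D "{p}" L 2 2 D M L] by blast
      then show ?thesis using 2 by blast
    next
      case 3
      show ?thesis
      proof (rule ccontr)
        assume no: "\<not> ?thesis"
        have no': "\<not> (\<exists>a. fam a D L M k)"
        proof
          assume "\<exists>a. fam a D L M k"
          then obtain a where "fam a D L M k" by blast
          then have "fam a D M L k" by (rule fam_rev)
          then show False using no by blast
        qed
        obtain S T where "absorbing_core D M L S T"
          using core_exists[OF adm 3 IH c3] no by blast
        then have ST: "S \<subseteq> D" "T \<subseteq> M" "\<And>u t. u \<in> S \<Longrightarrow> t \<in> T \<Longrightarrow> E u t" "card S < card T"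
          "L \<subseteq> S \<union> T" "\<And>v. v \<in> D - (S \<union> T) \<Longrightarrow> card {t \<in> T. E v t} \<le> card S + 1"
          unfolding absorbing_core_def by simp_all
        have c3': "3 \<le> cut D L M F" if "F \<subseteq> D" "F \<noteq> {}" "F \<noteq> D" for F
          using c3[OF that] unfolding cut_def by simp
        obtain S' T' where "absorbing_core D L M S' T'"
          using core_exists[OF adm_swap[OF adm] 3 IH c3'] no' by blast
        then have ST': "S' \<subseteq> D" "T' \<subseteq> L" "\<And>u t. u \<in> S' \<Longrightarrow> t \<in> T' \<Longrightarrow> E u t" "card S' < card T'"
          "M \<subseteq> S' \<union> T'"
          unfolding absorbing_core_def by simp_all
        have fin: "finite S" "finite T" "finite M" "finite L" "finite S'"
          using finite_subset[OF ST(1) D(1)] finite_subset[OF subset_trans[OF ST(2) D(2)] D(1)]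
            finite_subset[OF D(2) D(1)] finite_subset[OF D(3) D(1)] finite_subset[OF ST'(1) D(1)] .
        have "T \<noteq> {}" "T' \<noteq> {}" using ST(4) ST'(4) by auto
        then obtain t t' where t: "t \<in> T" and t': "t' \<in> T'" by blast
        have tM: "t \<in> M" "t' \<in> L" using t t' ST(2) ST'(2) by auto
        have cM: "col m = col t" if "m \<in> M" for m using that tM D(4) unfolding monochromatic_def by blast
        have cL: "col m = col t'" if "m \<in> L" for m using that tM D(5) unfolding monochromatic_def by blast
        have cS: "col u \<noteq> col t" if "u \<in> S" for u using bip ST(3)[OF that t] by blast
        have cS': "col u \<noteq> col t'" if "u \<in> S'" for u using bip ST'(3)[OF that t'] by blast
        \<comment> \<open>Both roots have all their neighbours in the core of the other one, so they are twins.\<close>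
        have eq: "T = M" "L = M"
        proof -
          have "col t = col t'"
          proof (rule ccontr)
            assume ne: "col t \<noteq> col t'"
            \<comment> \<open>Different colours lead to the circle \<open>card L \<le> card S < card
              T \<le> card M \<le> card S' < card T' \<le> card L\<close>.\<close>
            have "L \<subseteq> S" using ST(5) ST(2) cM cL ne by blast
            then have "card L \<le> card S" by (rule card_mono[OF fin(1)])
            have "M \<subseteq> S'" using ST'(5) ST'(2) cM cL ne by blast
            then have "card M \<le> card S'" by (rule card_mono[OF fin(5)])
            moreover have "card T \<le> card M" "card T' \<le> card L"
              using card_mono[OF fin(3) ST(2)] card_mono[OF fin(4) ST'(2)] .
            ultimately show False using \<open>card L \<le> card S\<close> ST(4) ST'(4) by linarith
          qed
          note ct = this
          have "l \<notin> S" if "l \<in> L" for l using cL[OF that] cS[of l] ct by auto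
          moreover have "m \<notin> S'" if "m \<in> M" for m using cM[OF that] cS'[of m] ct by auto
          ultimately have "L \<subseteq> T" "M \<subseteq> T'" using ST(5) ST'(5) by blast+
          then show "T = M" "L = M" using ST(2) ST'(2) by auto
        qed
        show False
        proof (cases "k \<le> card S + 1")
          case True
          have "fam 1 (S \<union> T) T {t} (card S + 1)"
            using fin ST t by (intro biclique_fam) auto
          then have "fam 1 D M L k"
            using fam_mono[OF _ True] ST(1,2) t eq D(2) by blast
          then show False using no by blast
        next
          case False
          then have ks: "card S + 2 \<le> k" by simp
          have "2 \<le> card T" using two_exits[OF adm _ c3] 3 eq by simp
          \<comment> \<open>Let \<open>t\<close> be the last vertex before \<open>y\<close>, i.e. replace the root \<open>y\<close> by \<open>t\<close>; if \<open>T\<close> becomes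
            too small for \<open>S\<close>, one vertex of \<open>S\<close> is dropped from the core as well.\<close>
          define D2 where "D2 = D - {t}"
          define T2 where "T2 = T - {t}"
          define L2 where "L2 = D2 \<inter> {u. E u t}"
          have tD: "t \<in> D" using tM D(2) by blast
          have cT2: "card T2 + 1 = card T"
            using card_Suc_Diff1[OF fin(2) t] unfolding T2_def by (metis Suc_eq_plus1)
          have fin2: "finite D2" using D(1) unfolding D2_def by simp
          have cD2: "card D2 < card D" using tD D(1) unfolding D2_def by (intro psubset_card_mono) auto
          have L2S: "S \<subseteq> L2"
            using ST(1,3) t cS unfolding L2_def D2_def by auto
          have TL2: "L2 \<inter> T = {}"
            using bip cM eq(1) unfolding L2_def by blast
          have "\<exists>S2. S2 \<subseteq> S \<and> card S2 < card T2 \<and> L2 - (S2 \<union> T2) \<noteq> {} \<and>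
              (S2 = S \<or> card T2 \<le> card S2 + 1)"
          proof (cases "card S + 2 \<le> card T")
            case True
            \<comment> \<open>The roots account for only two units of the degree of
              \<open>t\<close>. At least \<open>k - 1 > card S\<close> neighbours remain, and one of
              them is outside \<open>S\<close>, so the new root \<open>t\<close> has an exit from
              the core.\<close>
            have "nb D {t} \<subseteq> L2"
              using sym unfolding nb_def L2_def D2_def by auto
            moreover have "card S < card (nb D {t})"
              using cutk[OF tD] ks unfolding cut_def by (auto simp: of_bool_def split: if_splits)
            moreover have finL2: "finite L2" using fin2 unfolding L2_def by simp
            ultimately have "card S < card L2"
              using card_mono[OF finL2, of "nb D {t}"] by linarith
            then have "\<not> L2 \<subseteq> S" using card_mono[OF fin(1), of L2] by linarith
            then have "L2 - (S \<union> T2) \<noteq> {}" using TL2 unfolding T2_def by blast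
            then show ?thesis using True cT2 by (intro exI[of _ S]) auto
          next
            case F: False
            then have "card T = card S + 1" using ST(4) by linarith
            then have "S \<noteq> {}" using \<open>2 \<le> card T\<close> by auto
            then obtain s where s: "s \<in> S" by blast
            have "card (S - {s}) + 1 = card S"
              using card_Suc_Diff1[OF fin(1) s] by (metis Suc_eq_plus1)
            \<comment> \<open>The dropped vertex provides the exit.\<close>
            moreover have "s \<in> L2 - ((S - {s}) \<union> T2)"
              using s L2S TL2 unfolding T2_def by blast
            ultimately show ?thesis
              using cT2 \<open>card T = card S + 1\<close> by (intro exI[of _ "S - {s}"]) auto
          qed
          then obtain S2 where S2: "S2 \<subseteq> S" "card S2 < card T2" "L2 - (S2 \<union> T2) \<noteq> {}"
            "S2 = S \<or> card T2 \<le> card S2 + 1" by blast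
          have fS2: "finite S2" "finite T2" using finite_subset[OF S2(1) fin(1)] fin(2) unfolding T2_def by simp_all
          have S2D: "S2 \<subseteq> D2" using S2(1) L2S unfolding L2_def by blast
          have M2: "T2 \<subseteq> D2" "monochromatic T2"
            using eq D(2) monochromatic_subset[OF D(4)] unfolding T2_def D2_def by auto
          have L2: "L2 \<subseteq> D2" "monochromatic L2"
            using monochromatic_Int monochromatic_nbrs(2) unfolding L2_def by blast+
          have "(\<exists>a. fam a D2 T2 L2 k) \<or>
            (\<exists>G. G \<noteq> {} \<and> G \<subseteq> D2 - (S2 \<union> T2) \<and> nb D2 G \<inter> T2 = {} \<and> card (nb D2 G) + of_bool (G \<inter> L2 \<noteq> {}) \<le> 2)"
          proof (rule core_step[OF fin2 M2(1) L2(1) M2(2) L2(2) _ S2D order_refl _ S2(2) _ _ _ S2(3)])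
            show "\<exists>a. fam a D' M' L' k'" if "adm D' M' L' k'" "card D' < card D2" for D' M' L' k'
              using IH[OF that(1)] that(2) cD2 by simp
            show "E u w" if "u \<in> S2" "w \<in> T2" for u w
              using that S2(1) ST(3) unfolding T2_def by blast
            fix v assume v: "v \<in> D2 - (S2 \<union> T2)"
            show "card {w \<in> T2. E v w} \<le> card S2 + 1"
            proof (cases "S2 = S")
              case True
              then have "v \<in> D - (S \<union> T)" using v unfolding D2_def T2_def by auto
              then have "card {w \<in> T. E v w} \<le> card S2 + 1" using ST(6) True by blast
              moreover have "card {w \<in> T2. E v w} \<le> card {w \<in> T. E v w}"
                using fin(2) unfolding T2_def by (intro card_mono) auto
              ultimately show ?thesis by linarith
            next
              case False
              have "card {w \<in> T2. E v w} \<le> card T2" using fS2 by (intro card_mono) auto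
              then show ?thesis using False S2(4) by linarith
            qed
            show "card {u \<in> S2. E v u} + of_bool (v \<in> T2) \<le> card S2"
            proof -
              have "card {u \<in> S2. E v u} \<le> card S2" using fS2 by (intro card_mono) auto
              then show ?thesis using v by simp
            qed
            have "cut D M L {v} \<le> cut D2 T2 L2 {v} + 0"
            proof (rule cut_compare[OF fin2, of "if E v t then {t} else {}"])
              show "nb D {v} \<subseteq> nb D2 {v} \<union> (if E v t then {t} else {})"
                unfolding nb_def D2_def by auto
              have "v \<notin> M" using v eq unfolding D2_def T2_def by blast
              then show "card (if E v t then {t} else {}) + of_bool ({v} \<inter> M \<noteq> {}) + of_bool ({v} \<inter> L \<noteq> {})
                \<le> of_bool ({v} \<inter> T2 \<noteq> {}) + of_bool ({v} \<inter> L2 \<noteq> {}) + 0"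
                using v eq unfolding L2_def by auto
            qed auto
            moreover have "k + 1 \<le> cut D M L {v}" using cutk v unfolding D2_def by blast
            ultimately show "k + 1 \<le> cut D2 T2 L2 {v}" by simp
          qed
          then consider a where "fam a D2 T2 L2 k" | G where "G \<noteq> {}" "G \<subseteq> D2 - (S2 \<union> T2)"
            "card (nb D2 G) + of_bool (G \<inter> L2 \<noteq> {}) \<le> 2"
            by blast
          then show False
          proof cases
            case 1
            have "fam (a + length [t]) (D2 \<union> set [t]) T2 {last [t]} k"
            proof (rule fam_concat[OF _ fam_path[OF path_sing]])
              fix m assume "m \<in> {hd [t]}"
              then show "fam a D2 T2 {l. E l m} k"
                using fam_mono[OF 1 order_refl order_refl order_refl, of "{l. E l m}"]
                unfolding L2_def by auto
            next
              show "D2 \<inter> set [t] = {}" unfolding D2_def by auto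
            qed (use 3 in auto)
            then have "fam (a + 1) D M L k"
              using fam_mono[of "a + 1" "D2 \<union> {t}" T2 "{t}" k k D M L] eq tD tM
              unfolding D2_def T2_def by auto
            then show False using no by blast
          next
            case 2
            \<comment> \<open>Since \<open>M\<close> and \<open>L\<close> both equal
              \<open>T\<close>, no vertex of \<open>G\<close> is adjacent to an old root. So a bad
              piece of the new rooted graph has a cut of at most 2 in the old one.\<close>
            have GM: "G \<inter> M = {}" "G \<inter> L = {}"
              using 2(2) eq unfolding D2_def T2_def by auto
            have "cut D M L G \<le> cut D2 {} L2 G + 0"
            proof (rule cut_compare[OF fin2, of "if G \<inter> L2 \<noteq> {} then {t} else {}"])
              show "nb D G \<subseteq> nb D2 G \<union> (if G \<inter> L2 \<noteq> {} then {t} else {})"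
                using 2(2) unfolding nb_def D2_def L2_def by auto
            qed (use GM in auto)
            then have "cut D M L G \<le> 2"
              using 2(3) unfolding cut_def by simp
            moreover have "G \<subseteq> D" "G \<noteq> D" using 2(2) tD unfolding D2_def by auto
            ultimately show False using c3[of G] 2(1) by simp
          qed
        qed
      qed
    qed
  qed
qed

subsection \<open>From paths to cycles\<close>

lemma closed_path_cycle:
  assumes "path q" "E (last q) (hd q)" "j < length q"
  shows "E (q ! j) (q ! ((j + 1) mod length q))"
proof (cases "Suc j < length q")
  case True
  then show ?thesis
    using assms(1) unfolding path_def successively_conv_nth by simp
next
  case False
  then have "length q = Suc j" using assms(3) by simp
  then show ?thesis
    using assms(2) path_nonempty[OF assms(1)] by (simp add: last_conv_nth hd_conv_nth)
qed

lemma consecutive_even_cycles: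
  assumes fin: "finite V" and ne: "V \<noteq> {}" and k: "1 \<le> k"
    and deg: "\<And>v. v \<in> V \<Longrightarrow> k + 1 \<le> card {u \<in> V. E v u}"
  shows "\<exists>m\<ge>2. \<forall>i<k. has_cycle_of_length V E (2 * m + 2 * i)"
proof -
  \<comment> \<open>A smallest such \<open>D\<close> together with \<open>c\<close> is an end block,
    or a component without cut vertex. An edge from \<open>c\<close> to some \<open>w\<close> in
    \<open>D\<close> will close the cycles, and \<open>c\<close> and \<open>w\<close> become the
    roots.\<close>
  define P where "P D \<longleftrightarrow> D \<noteq> {} \<and> (\<exists>c\<in>V. D \<subseteq> V - {c} \<and> nb V D \<subseteq> {c})" for D
  have nb1: "nb V {v} = {u \<in> V. E v u}" for v
    unfolding nb_def using irrefl by auto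
  have two: "\<exists>u\<in>V. E v u \<and> u \<noteq> x" if "v \<in> V" for v x
  proof (rule ccontr)
    assume "\<not> ?thesis"
    then have "{u \<in> V. E v u} \<subseteq> {x}" by blast
    then have "card {u \<in> V. E v u} \<le> 1" using card_mono[of "{x}"] by fastforce
    then show False using deg[OF that] k by linarith
  qed
  obtain c0 where c0: "c0 \<in> V" using ne by blast
  then have "V - {c0} \<noteq> {}" using two[OF c0, of c0] by blast
  then have "P (V - {c0})" using c0 unfolding P_def nb_def by blast
  then obtain D where D: "P D" and Dmin: "\<And>F. P F \<Longrightarrow> card D \<le> card F"
    using ex_has_least_nat[of P "V - {c0}" card] by blast
  then obtain c where c: "c \<in> V" "D \<subseteq> V - {c}" "nb V D \<subseteq> {c}" "D \<noteq> {}"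
    unfolding P_def by blast
  have finD: "finite D" using c(2) fin finite_subset by blast
  have cutF: "2 \<le> card (nb V F)" if F: "F \<subset> D" "F \<noteq> {}" for F
  proof (rule ccontr)
    assume "\<not> ?thesis"
    then have "card (nb V F) = 0 \<or> card (nb V F) = 1" by linarith
    then have "nb V F = {} \<or> (\<exists>z. nb V F = {z})"
      using finite_nb[OF fin, of F] by (auto simp: card_1_singleton_iff)
    then have "P F"
    proof
      assume "nb V F = {}"
      then show "P F" unfolding P_def using F c(1,2) by blast
    next
      assume "\<exists>z. nb V F = {z}"
      then obtain z where z: "nb V F = {z}" by blast
      then have "z \<in> V" "z \<notin> F" unfolding nb_def by blast+
      then show "P F" unfolding P_def using F c(2) z by blast
    qed
    then show False using Dmin[of F] psubset_card_mono[OF finD F(1)] by simp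
  qed
  have "nb V D \<noteq> {}"
  proof
    assume n: "nb V D = {}"
    obtain d where d: "d \<in> D" using c(4) by blast
    then obtain u where "u \<in> V" "E d u" "u \<noteq> d" using two[of d d] c(2) by blast
    then have "u \<in> D - {d}" using n d unfolding nb_def by blast
    then have "2 \<le> card (nb V (D - {d}))" using d by (intro cutF) auto
    moreover have "nb V (D - {d}) \<subseteq> {d}" using n unfolding nb_def by blast
    then have "card (nb V (D - {d})) \<le> card {d}" by (intro card_mono) auto
    ultimately show False by simp
  qed
  then have "c \<in> nb V D" using c(3) by blast
  then obtain w where w: "w \<in> D" "E w c" unfolding nb_def by blast
  define D2 where "D2 = D - {w}"
  define M where "M = D2 \<inter> {u. E c u}"
  define L where "L = D2 \<inter> {u. E u w}"
  have fin2: "finite D2" using finD unfolding D2_def by simp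
  have D2V: "D2 \<subset> D" using w unfolding D2_def by blast
  have D2n: "D2 \<noteq> {}"
  proof -
    obtain u where "u \<in> V" "E w u" "u \<noteq> c" using two[of w c] w(1) c(2) by blast
    then have "u \<in> D" using c(3) w(1) unfolding nb_def by blast
    then show ?thesis using \<open>E w u\<close> irrefl unfolding D2_def by blast
  qed
  have le: "card (nb V F) \<le> cut D2 M L F" if F: "F \<subseteq> D2" for F
  proof -
    define X1 where "X1 = (if F \<inter> M \<noteq> {} then {c} else {})"
    define X2 where "X2 = (if F \<inter> L \<noteq> {} then {w} else {})"
    have "nb V F \<subseteq> nb D2 F \<union> (X1 \<union> X2)"
    proof
      fix z assume "z \<in> nb V F"
      then obtain v where v: "v \<in> F" "E v z" "z \<in> V - F" unfolding nb_def by blast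
      show "z \<in> nb D2 F \<union> (X1 \<union> X2)"
      proof (cases "z \<in> D2")
        case True
        then show ?thesis using v unfolding nb_def by blast
      next
        case False
        then have "z = w \<or> z \<notin> D" unfolding D2_def by blast
        then have "z = w \<or> z \<in> nb V D"
          using v F D2V unfolding nb_def by blast
        then have "z = w \<or> z = c" using c(3) by blast
        then show ?thesis
        proof
          assume "z = w"
          then have "v \<in> F \<inter> L" using v F unfolding L_def by blast
          then show ?thesis using \<open>z = w\<close> unfolding X2_def by auto
        next
          assume "z = c"
          then have "v \<in> F \<inter> M" using v F sym unfolding M_def by blast
          then show ?thesis using \<open>z = c\<close> unfolding X1_def by auto
        qed
      qed
    qed
    moreover have "card (X1 \<union> X2) \<le> card X1 + card X2" by (rule card_Un_le)
    moreover have "card X1 = of_bool (F \<inter> M \<noteq> {})" "card X2 = of_bool (F \<inter> L \<noteq> {})"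
      unfolding X1_def X2_def by simp_all
    moreover have "finite (X1 \<union> X2)" unfolding X1_def X2_def by simp
    ultimately have "cut V {} {} F \<le> cut D2 M L F + 0"
      by (intro cut_compare[OF fin2, of "X1 \<union> X2"]) simp_all
    then show ?thesis unfolding cut_def by simp
  qed
  have "adm D2 M L k"
    unfolding adm_def
  proof (intro conjI ballI allI impI)
    show "monochromatic M" unfolding M_def by (simp add: monochromatic_Int monochromatic_nbrs)
    show "monochromatic L" unfolding L_def by (simp add: monochromatic_Int monochromatic_nbrs)
    fix v assume v: "v \<in> D2"
    then have "v \<in> V" using D2V c(2) by blast
    then show "k + 1 \<le> cut D2 M L {v}"
      using le[of "{v}"] v deg[of v] nb1[of v] by simp
  next
    fix F assume F: "F \<subseteq> D2" "F \<noteq> {}"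
    then have "2 \<le> card (nb V F)" using D2V by (intro cutF) auto
    then show "2 \<le> cut D2 M L F" using le[OF F(1)] by linarith
  qed (use fin2 D2n in \<open>auto simp: M_def L_def\<close>)
  then obtain a where a: "fam a D2 M L k" using adm_fam by blast
  \<comment> \<open>The ends of \<open>p\<close> are adjacent to the two ends of the edge
    \<open>c w\<close>, hence differ in colour, and \<open>p\<close> has an even number of vertices.
    The cycle has two more, which explains the witness \<open>b + 1\<close> for
    \<open>a = 2 * b\<close>.\<close>
  have cyc: "even (a + 2 * i) \<and> 2 \<le> a + 2 * i \<and> has_cycle_of_length V E (a + 2 + 2 * i)" if i: "i < k" for i
  proof -
    obtain p where p: "path p" "set p \<subseteq> D2" "hd p \<in> M" "last p \<in> L" "length p = a + 2 * i"
      using a i unfolding fam_def by blast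
    have pn: "p \<noteq> []" using p(1) by (rule path_nonempty)
    have "E c (hd p)" "E (last p) w" using p(3,4) unfolding M_def L_def by auto
    then have "col (hd p) \<noteq> col (last p)" using bip[of c "hd p"] bip[of "last p" w] bip[OF w(2)] by auto
    then have ev: "even (length p)" using path_parity[OF p(1)] by blast
    then have l2: "2 \<le> length p" using pn by (cases p; cases "tl p") auto
    let ?q = "c # p @ [w]"
    have wp: "w \<notin> set p" "c \<notin> set p" "c \<noteq> w"
      using p(2) c(2) w(1) unfolding D2_def by auto
    have "path (p @ [w])"
      using p(1) pn wp \<open>E (last p) w\<close> by (subst path_append) (auto simp: path_sing)
    then have q: "path ?q"
      using \<open>E c (hd p)\<close> pn wp by (auto simp: path_Cons)
    have "E (last ?q) (hd ?q)" using w(2) by simp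
    then have "\<forall>j<length ?q. E (?q ! j) (?q ! ((j + 1) mod length ?q))"
      using closed_path_cycle[OF q] by blast
    moreover have "distinct ?q" using q unfolding path_def by blast
    moreover have "set ?q \<subseteq> V" using p(2) c w(1) unfolding D2_def by auto
    moreover have "length ?q = a + 2 + 2 * i" using p(5) by simp
    ultimately have "has_cycle_of_length V E (a + 2 + 2 * i)"
      unfolding has_cycle_of_length_def using l2 p(5) by (intro conjI exI[of _ ?q]) auto
    then show ?thesis using ev l2 p(5) by simp
  qed
  have "even a" "2 \<le> a" using cyc[of 0] k by simp_all
  then obtain b where b: "a = 2 * b" by (rule_tac evenE)
  show ?thesis
  proof (intro exI[of _ "b + 1"] conjI allI impI)
    show "2 \<le> b + 1" using b \<open>2 \<le> a\<close> by simp
    fix i assume "i < k"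
    then show "has_cycle_of_length V E (2 * (b + 1) + 2 * i)"
      using cyc[of i] b by (simp add: algebra_simps)
  qed
qed

end

text \<open>The edges of the cut given by \<open>A\<close>. The set is not tied to a vertex set, so
  one \<open>A\<close> serves all vertex subsets and can be altered at single vertices in the
  inductions.\<close>

definition crossing :: "('a \<Rightarrow> 'a \<Rightarrow> bool) \<Rightarrow> 'a set \<Rightarrow> 'a \<Rightarrow> 'a \<Rightarrow> bool" where
  "crossing E A x y \<longleftrightarrow> E x y \<and> (x \<in> A \<longleftrightarrow> y \<notin> A)"

lemma num_edges_cong:
  assumes "\<And>x y. x \<in> V \<Longrightarrow> y \<in> V \<Longrightarrow> E x y = E' x y"
  shows "num_edges V E = num_edges V E'"
proof -
  have "edges V E = edges V E'"
    unfolding edges_def using assms by blast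
  then show ?thesis unfolding num_edges_def by simp
qed

lemma finite_edges: "finite V \<Longrightarrow> finite (edges V E)"
  by (rule finite_subset[of _ "Pow V"]) (auto simp: edges_def)

section \<open>Dense bipartite subgraphs\<close>

lemma card_split:
  assumes "finite V"
  shows "card {u \<in> V. E v u} = card {u \<in> V. E v u \<and> u \<in> A} + card {u \<in> V. E v u \<and> u \<notin> A}"
proof -
  have "{u \<in> V. E v u} = {u \<in> V. E v u \<and> u \<in> A} \<union> {u \<in> V. E v u \<and> u \<notin> A}" by blast
  then show ?thesis
    using assms by (simp add: card_Un_disjoint disjoint_iff)
qed

lemma four_mult_le: "4 * (a * b) \<le> (a + b) * (a + b)" for a b :: nat
proof (cases "a \<le> b")
  case True
  then obtain d where "b = a + d" using le_Suc_ex by blast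
  then show ?thesis by (simp add: algebra_simps)
next
  case False
  then obtain d where "a = b + d" using le_Suc_ex nat_le_linear by metis
  then show ?thesis by (simp add: algebra_simps)
qed

text \<open>A product with fixed sum is largest for equal factors. The bound is what stops the
  vertex deletion in \<open>min_degree_subgraph\<close>.\<close>

lemma bipartite_num_edges_le:
  assumes "finite V"
  shows "4 * num_edges V (crossing E A) \<le> card V * card V"
proof -
  have "edges V (crossing E A) \<subseteq> (\<lambda>(x, y). {x, y}) ` ((V \<inter> A) \<times> (V - A))"
  proof
    fix e assume "e \<in> edges V (crossing E A)"
    then obtain x y where xy: "e = {x, y}" "x \<in> V" "y \<in> V" "x \<in> A \<longleftrightarrow> y \<notin> A"
      unfolding edges_def crossing_def by blast
    show "e \<in> (\<lambda>(x, y). {x, y}) ` ((V \<inter> A) \<times> (V - A))"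
    proof (cases "x \<in> A")
      case True
      then show ?thesis using xy by (intro image_eqI[of _ _ "(x, y)"]) auto
    next
      case False
      then show ?thesis using xy by (intro image_eqI[of _ _ "(y, x)"]) auto
    qed
  qed
  then have "num_edges V (crossing E A) \<le> card ((V \<inter> A) \<times> (V - A))"
    unfolding num_edges_def using assms by (intro surj_card_le) auto
  also have "\<dots> = card (V \<inter> A) * card (V - A)" by (rule card_cartesian_product)
  finally have "num_edges V (crossing E A) \<le> card (V \<inter> A) * card (V - A)" .
  moreover have "card (V \<inter> A) + card (V - A) = card V"
    using assms by (metis Diff_Int_distrib2 card_Int_Diff)
  ultimately show ?thesis
    using four_mult_le[of "card (V \<inter> A)" "card (V - A)"] by simp
qed

locale irreflexive_graph =
  fixes E :: "'a \<Rightarrow> 'a \<Rightarrow> bool"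
  assumes sym: "E u v \<Longrightarrow> E v u"
    and irrefl: "\<not> E v v"
begin

lemma num_edges_insert:
  assumes "finite V" "v \<notin> V"
  shows "num_edges (insert v V) E = num_edges V E + card {u \<in> V. E v u}"
proof -
  have eq: "edges (insert v V) E = edges V E \<union> (\<lambda>u. {v, u}) ` {u \<in> V. E v u}"
  proof
    show "edges (insert v V) E \<subseteq> edges V E \<union> (\<lambda>u. {v, u}) ` {u \<in> V. E v u}"
    proof
      fix e assume "e \<in> edges (insert v V) E"
      then obtain x y where xy: "e = {x, y}" "x \<in> insert v V" "y \<in> insert v V" "E x y"
        unfolding edges_def by blast
      show "e \<in> edges V E \<union> (\<lambda>u. {v, u}) ` {u \<in> V. E v u}"
      proof (cases "x = v \<or> y = v")
        case True
        then show ?thesis using xy irrefl sym by (auto simp: doubleton_eq_iff)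
      next
        case False
        then show ?thesis using xy unfolding edges_def by blast
      qed
    qed
    show "edges V E \<union> (\<lambda>u. {v, u}) ` {u \<in> V. E v u} \<subseteq> edges (insert v V) E"
      unfolding edges_def by blast
  qed
  have disj: "edges V E \<inter> (\<lambda>u. {v, u}) ` {u \<in> V. E v u} = {}"
    using assms(2) unfolding edges_def by (auto simp: doubleton_eq_iff)
  have "inj_on (\<lambda>u. {v, u}) {u \<in> V. E v u}"
    using assms(2) by (auto simp: inj_on_def doubleton_eq_iff)
  then have "card ((\<lambda>u. {v, u}) ` {u \<in> V. E v u}) = card {u \<in> V. E v u}"
    by (rule card_image)
  then show ?thesis
    unfolding num_edges_def eq
    using card_Un_disjoint[OF finite_edges[OF assms(1), of E] _ disj] assms(1) by simp
qed

lemma crossing_graph: "irreflexive_graph (crossing E A)"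
  using sym irrefl by unfold_locales (auto simp: crossing_def)

lemmas num_edges_crossing_insert = irreflexive_graph.num_edges_insert[OF crossing_graph]

text \<open>Vertices are added one at a time, each to the side with at most half of its earlier
  neighbours.\<close>

lemma half_cut:
  assumes "finite V"
  shows "\<exists>A. num_edges V E \<le> 2 * num_edges V (crossing E A)"
  using assms(1)
proof (induction V)
  case empty
  then show ?case by (simp add: num_edges_def edges_def)
next
  case (insert v V)
  then obtain A where A: "num_edges V E \<le> 2 * num_edges V (crossing E A)" by blast
  define B where "B = (if card {u \<in> V. E v u \<and> u \<notin> A} \<le> card {u \<in> V. E v u \<and> u \<in> A} then A - {v} else insert v A)"
  have "num_edges V (crossing E B) = num_edges V (crossing E A)"
    using insert.hyps(2) by (intro num_edges_cong) (auto simp: crossing_def B_def)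
  moreover have "card {u \<in> V. E v u} \<le> 2 * card {u \<in> V. crossing E B v u}"
  proof (cases "card {u \<in> V. E v u \<and> u \<notin> A} \<le> card {u \<in> V. E v u \<and> u \<in> A}")
    case True
    then have "{u \<in> V. crossing E B v u} = {u \<in> V. E v u \<and> u \<in> A}"
      using insert.hyps(2) unfolding crossing_def B_def by auto
    then have "card {u \<in> V. crossing E B v u} = card {u \<in> V. E v u \<and> u \<in> A}"
      by (rule arg_cong)
    then show ?thesis using True card_split[OF insert.hyps(1), of E v A] by linarith
  next
    case False
    then have "{u \<in> V. crossing E B v u} = {u \<in> V. E v u \<and> u \<notin> A}"
      using insert.hyps(2) unfolding crossing_def B_def by auto
    then have "card {u \<in> V. crossing E B v u} = card {u \<in> V. E v u \<and> u \<notin> A}"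
      by (rule arg_cong)
    then show ?thesis using False card_split[OF insert.hyps(1), of E v A] by linarith
  qed
  ultimately have "num_edges (insert v V) E \<le> 2 * num_edges (insert v V) (crossing E B)"
    using A num_edges_insert[OF insert.hyps] num_edges_crossing_insert[OF insert.hyps, of B]
    by linarith
  then show ?case by blast
qed

text \<open>Put \<open>u\<close> and \<open>v\<close> on different sides in both possible ways. The
  two cuts together contain each edge between \<open>{u, v}\<close> and \<open>W\<close> once and
  the edge \<open>u v\<close> twice, so the better one gains one half over half of the edges added
  to \<open>W\<close>.\<close>

lemma edge_cut_step:
  assumes fin: "finite V" and uv: "u \<in> V" "v \<in> V" "E u v"
   
  defines "W \<equiv> V - {u, v}"
  shows "num_edges V E = num_edges W E + card {w \<in> W. E u w} + card {w \<in> W. E v w} + 1"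
    and "\<exists>B. num_edges V E + 2 * num_edges W (crossing E A) + 1 \<le> 2 * num_edges V (crossing E B) + num_edges W E"
proof -
  have uvn: "u \<noteq> v" using uv irrefl by blast
  have V: "V = insert u (insert v W)" using uv unfolding W_def by blast
  have finW: "finite W" "finite (insert v W)" using fin unfolding W_def by auto
  have nW: "v \<notin> W" "u \<notin> insert v W" using uvn unfolding W_def by auto
  have "{w \<in> insert v W. E u w} = insert v {w \<in> W. E u w}" using uv(3) by blast
  then have "card {w \<in> insert v W. E u w} = card {w \<in> W. E u w} + 1"
    using finW nW by simp
  then show e: "num_edges V E = num_edges W E + card {w \<in> W. E u w} + card {w \<in> W. E v w} + 1"
    unfolding V using num_edges_insert[OF finW(2) nW(2)] num_edges_insert[OF finW(1) nW(1)]
    by simp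
  have c: "num_edges V (crossing E B) = num_edges W (crossing E A)
      + card {w \<in> W. crossing E B u w} + card {w \<in> W. crossing E B v w} + 1"
    if B: "B - {u, v} = A - {u, v}" "u \<in> B \<longleftrightarrow> v \<notin> B" for B
  proof -
    have "{w \<in> insert v W. crossing E B u w} = insert v {w \<in> W. crossing E B u w}"
      using uv(3) B(2) unfolding crossing_def by blast
    then have "card {w \<in> insert v W. crossing E B u w} = card {w \<in> W. crossing E B u w} + 1"
      using finW nW by simp
    moreover have "num_edges W (crossing E B) = num_edges W (crossing E A)"
      using B(1) by (intro num_edges_cong) (auto simp: crossing_def W_def)
    ultimately show ?thesis
      unfolding V using num_edges_crossing_insert[OF finW(2) nW(2), of B]
        num_edges_crossing_insert[OF finW(1) nW(1), of B] by simp
  qed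
  define B1 where "B1 = insert u (A - {v})"
  define B2 where "B2 = insert v (A - {u})"
  have c1: "num_edges V (crossing E B1) = num_edges W (crossing E A)
      + card {w \<in> W. crossing E B1 u w} + card {w \<in> W. crossing E B1 v w} + 1"
    using uvn unfolding B1_def by (intro c) auto
  have c2: "num_edges V (crossing E B2) = num_edges W (crossing E A)
      + card {w \<in> W. crossing E B2 u w} + card {w \<in> W. crossing E B2 v w} + 1"
    using uvn unfolding B2_def by (intro c) auto
  have "{w \<in> W. crossing E B1 u w} = {w \<in> W. E u w \<and> w \<notin> A}" "{w \<in> W. crossing E B1 v w} = {w \<in> W. E v w \<and> w \<in> A}"
    "{w \<in> W. crossing E B2 u w} = {w \<in> W. E u w \<and> w \<in> A}" "{w \<in> W. crossing E B2 v w} = {w \<in> W. E v w \<and> w \<notin> A}"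
    using uvn unfolding B1_def B2_def W_def crossing_def by auto
  then have "num_edges V (crossing E B1) + num_edges V (crossing E B2) =
      2 * num_edges W (crossing E A) + card {w \<in> W. E u w} + card {w \<in> W. E v w} + 2"
    using c1 c2 card_split[OF finW(1), of E u A] card_split[OF finW(1), of E v A] by simp
  then have "num_edges V E + 2 * num_edges W (crossing E A) + 1 \<le> 2 * num_edges V (crossing E B1) + num_edges W E
    \<or> num_edges V E + 2 * num_edges W (crossing E A) + 1 \<le> 2 * num_edges V (crossing E B2) + num_edges W E"
    using e by linarith
  then show "\<exists>B. num_edges V E + 2 * num_edges W (crossing E A) + 1 \<le> 2 * num_edges V (crossing E B) + num_edges W E"
    by blast
qed

lemma exists_edge:
  assumes "0 < num_edges V E"
  obtains u v where "u \<in> V" "v \<in> V" "E u v"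
proof -
  have "edges V E \<noteq> {}" using assms unfolding num_edges_def by (auto simp: card_gt_0_iff)
  then show ?thesis using that unfolding edges_def by blast
qed

text \<open>
  Deleting the two ends of an edge removes at most \<open>2 * card V - 3\<close> edges, which is exactly the
  change of the bound from \<open>k\<close> to \<open>k - 1\<close>; so \<open>k + 1\<close> disjoint edges can be chosen greedily, and
  each of them contributes a surplus of one half to the cut.
\<close>

lemma matching_cut:
  assumes "finite V"
    and "2 * k + 2 \<le> card V" "2 * k * card V + 1 \<le> num_edges V E + 2 * k * k + k"
  shows "\<exists>A. num_edges V E + k + 1 \<le> 2 * num_edges V (crossing E A)"
  using assms
proof (induction k arbitrary: V)
  case 0
  then obtain u v where uv: "u \<in> V" "v \<in> V" "E u v" using exists_edge[of V] by auto
  obtain A where "num_edges (V - {u, v}) E \<le> 2 * num_edges (V - {u, v}) (crossing E A)"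
    using half_cut[of "V - {u, v}"] 0(1) by auto
  moreover obtain B where "num_edges V E + 2 * num_edges (V - {u, v}) (crossing E A) + 1
      \<le> 2 * num_edges V (crossing E B) + num_edges (V - {u, v}) E"
    using edge_cut_step(2)[OF 0(1) uv] by blast
  ultimately have "num_edges V E + 0 + 1 \<le> 2 * num_edges V (crossing E B)" by linarith
  then show ?case by blast
next
  case (Suc k)
  have "Suc k * 2 * card V = 2 * k * card V + 2 * card V" by simp
  then have big: "2 * k * card V + 2 * card V + 1 \<le> num_edges V E + 2 * k * k + 5 * k + 3"
    using Suc.prems(3) by (simp add: algebra_simps)
  have kk: "2 * k * card V \<ge> 2 * k * (2 * k + 4)" using Suc.prems(2) by (intro mult_le_mono) auto
  then have "2 * k * card V \<ge> 4 * k * k + 8 * k" by (simp add: algebra_simps)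
  then have "0 < num_edges V E" using big Suc.prems(2) by simp
  then obtain u v where uv: "u \<in> V" "v \<in> V" "E u v" using exists_edge[of V] by auto
  let ?W = "V - {u, v}"
  have uvn: "u \<noteq> v" using uv irrefl by blast
  then have cW: "card ?W + 2 = card V"
    using uv Suc.prems(1,2) by (simp add: card_Diff_subset)
  have "card {w \<in> ?W. E u w} \<le> card ?W" "card {w \<in> ?W. E v w} \<le> card ?W"
    using Suc.prems(1) by (auto intro!: card_mono)
  then have "num_edges V E \<le> num_edges ?W E + 2 * card ?W + 1"
    using edge_cut_step(1)[OF Suc.prems(1) uv] by linarith
  moreover have "2 * k * card V = 2 * k * card ?W + 4 * k"
    unfolding cW[symmetric] by (simp add: algebra_simps)
  ultimately have "2 * k * card ?W + 1 \<le> num_edges ?W E + 2 * k * k + k"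
    using big cW by linarith
  moreover have "2 * Suc k + 2 \<le> c + 2 \<Longrightarrow> 2 * k + 2 \<le> c" for c
    by simp
  then have "2 * k + 2 \<le> card ?W"
    using Suc.prems(2) cW by metis
  ultimately obtain A where "num_edges ?W E + k + 1 \<le> 2 * num_edges ?W (crossing E A)"
    using Suc.IH[of ?W] Suc.prems(1) by auto
  moreover obtain B where "num_edges V E + 2 * num_edges ?W (crossing E A) + 1
      \<le> 2 * num_edges V (crossing E B) + num_edges ?W E"
    using edge_cut_step(2)[OF Suc.prems(1) uv] by blast
  ultimately have "num_edges V E + Suc k + 1 \<le> 2 * num_edges V (crossing E B)" by linarith
  then show ?case by blast
qed

lemma complete_num_edges:
  assumes "finite V"
    and "\<And>x y. x \<in> V \<Longrightarrow> y \<in> V \<Longrightarrow> x \<noteq> y \<Longrightarrow> E x y"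
  shows "2 * num_edges V E + card V = card V * card V"
  using assms
proof (induction V)
  case empty
  then show ?case by (simp add: num_edges_def edges_def)
next
  case (insert v V)
  have "{u \<in> V. E v u} = V" using insert.prems insert.hyps(2) by auto
  then have "num_edges (insert v V) E = num_edges V E + card V"
    using num_edges_insert[OF insert.hyps] by simp
  then show ?case
    using insert by simp
qed

text \<open>
  \<open>matching_cut\<close> needs one edge more than the hypothesis provides. In the case of equality the
  graph is not complete, so the first pair can be chosen with an end that is not
  adjacent to all other vertices, and this saves one edge.
\<close>

lemma dense_cut:
  assumes fin: "finite V"
    and k: "1 \<le> k" and n: "2 * k + 2 \<le> card V" and e: "2 * k * card V \<le> num_edges V E + 2 * k * k + k"
  shows "\<exists>A. num_edges V E + k + 1 \<le> 2 * num_edges V (crossing E A)"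
proof (cases "2 * k * card V + 1 \<le> num_edges V E + 2 * k * k + k")
  case True
  then show ?thesis using matching_cut[OF fin n] by blast
next
  case False
  then have eq: "2 * k * card V = num_edges V E + 2 * k * k + k" using e by linarith
  have "2 * k * (2 * k + 2) \<le> 2 * k * card V" using n by (intro mult_le_mono) auto
  then have "4 * k * k + 4 * k \<le> 2 * k * card V" by (simp add: algebra_simps)
  then have "0 < num_edges V E" using eq k by simp
  then obtain x y where xy: "x \<in> V" "y \<in> V" "E x y" using exists_edge[of V] by auto
  have "\<exists>a\<in>V. \<exists>b\<in>V. a \<noteq> b \<and> \<not> E a b"
  proof (rule ccontr)
    assume "\<not> ?thesis"
    then have c: "2 * num_edges V E + card V = card V * card V"
      by (intro complete_num_edges[OF fin]) auto
    obtain d where d: "card V = 2 * k + 2 + d" using n le_Suc_ex by metis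
    \<comment> \<open>In terms of \<open>d\<close> the two edge counts amount to
      \<open>(d + 2) * (d + 1) = 0\<close>.\<close>
    show False using c eq unfolding d by (simp add: algebra_simps)
  qed
  then obtain a b where ab: "a \<in> V" "b \<in> V" "a \<noteq> b" "\<not> E a b" by blast
  \<comment> \<open>If \<open>a\<close> has a neighbour, it is the required \<open>u\<close>; an
    isolated \<open>a\<close> is a non-neighbour of \<open>x\<close>.\<close>
  have "\<exists>u\<in>V. \<exists>v\<in>V. \<exists>w\<in>V. E u v \<and> u \<noteq> w \<and> \<not> E u w"
  proof (cases "\<exists>v\<in>V. E a v")
    case True
    then show ?thesis using ab by blast
  next
    case False
    then have "\<not> E x a" "x \<noteq> a" using xy sym by blast+
    then show ?thesis using xy ab by blast
  qed
  then obtain u v w where uv: "u \<in> V" "v \<in> V" "E u v" and w: "w \<in> V" "u \<noteq> w" "\<not> E u w" by blast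
  let ?W = "V - {u, v}"
  have uvn: "u \<noteq> v" using uv irrefl by blast
  then have cW: "card ?W + 2 = card V"
    using uv fin n by (simp add: card_Diff_subset)
  have finW: "finite ?W" using fin by simp
  have "w \<in> ?W" using w uv by blast
  then have "{z \<in> ?W. E u z} \<subset> ?W" using w by blast
  then have "card {z \<in> ?W. E u z} < card ?W" by (rule psubset_card_mono[OF finW])
  moreover have "card {z \<in> ?W. E v z} \<le> card ?W" by (intro card_mono finW) auto
  ultimately have eW: "num_edges V E \<le> num_edges ?W E + 2 * card ?W"
    using edge_cut_step(1)[OF fin uv] by linarith
  obtain j where j: "k = Suc j" using k by (cases k) auto
  have "2 * j * card ?W + 1 \<le> num_edges ?W E + 2 * j * j + j"
  proof -
    have "card V = card ?W + 2" using cW by simp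
    then have "2 * Suc j * (card ?W + 2) = num_edges V E + 2 * Suc j * Suc j + Suc j" using eq j by simp
    then have "2 * j * card ?W + 4 * j + 2 * card ?W + 4 = num_edges V E + 2 * j * j + 5 * j + 3"
      by (simp add: algebra_simps)
    then show ?thesis using eW by linarith
  qed
  moreover have "2 * Suc j + 2 \<le> c + 2 \<Longrightarrow> 2 * j + 2 \<le> c" for c
    by simp
  then have "2 * j + 2 \<le> card ?W"
    using n j cW by metis
  ultimately obtain A where "num_edges ?W E + j + 1 \<le> 2 * num_edges ?W (crossing E A)"
    using matching_cut[OF finW] by blast
  moreover obtain B where "num_edges V E + 2 * num_edges ?W (crossing E A) + 1
      \<le> 2 * num_edges V (crossing E B) + num_edges ?W E"
    using edge_cut_step(2)[OF fin uv] by blast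
  ultimately have "num_edges V E + k + 1 \<le> 2 * num_edges V (crossing E B)" using j by linarith
  then show ?thesis by blast
qed

text \<open>Deleting a vertex of degree at most \<open>k\<close> preserves the excess over
  \<open>k * (n - k)\<close>. With \<open>2 * k\<close> vertices left, the excess would mean more
  than \<open>k * k\<close> edges, too many for a bipartite graph, so the deletion stops
  earlier.\<close>

lemma min_degree_subgraph:
  assumes "finite V"
    and k: "1 \<le> k" and "2 * k \<le> card V" "k * card V + 1 \<le> num_edges V (crossing E A) + k * k"
  shows "\<exists>W\<subseteq>V. W \<noteq> {} \<and> (\<forall>v\<in>W. k + 1 \<le> card {u \<in> W. crossing E A v u})"
  using assms(1,3,4)
proof (induction "card V" arbitrary: V)
  case 0
  then show ?case using k by simp
next
  case (Suc n)
  show ?case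
  proof (cases "\<forall>v\<in>V. k + 1 \<le> card {u \<in> V. crossing E A v u}")
    case True
    then show ?thesis using Suc.hyps(2) by (intro exI[of _ V]) auto
  next
    case False
    then obtain v where v: "v \<in> V" "card {u \<in> V. crossing E A v u} \<le> k" by force
    let ?W = "V - {v}"
    have V: "V = insert v ?W" using v by blast
    have fW: "finite ?W" "v \<notin> ?W" using Suc.prems(1) by auto
    have cW: "n = card ?W" using Suc.hyps(2) Suc.prems(1) v(1) by simp
    have "card {u \<in> ?W. crossing E A v u} \<le> card {u \<in> V. crossing E A v u}"
      using Suc.prems(1) by (intro card_mono) auto
    then have "num_edges V (crossing E A) \<le> num_edges ?W (crossing E A) + k"
      using num_edges_crossing_insert[OF fW, of A] v(2) V by simp
    moreover have "k * card V = k * card ?W + k" using Suc.hyps(2) cW by (metis mult_Suc_right add.commute)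
    ultimately have e: "k * card ?W + 1 \<le> num_edges ?W (crossing E A) + k * k"
      using Suc.prems(3) by linarith
    have "2 * k \<noteq> card V"
    proof
      assume "2 * k = card V"
      then have "card V * card V = 4 * (k * k)"
        by (simp flip: \<open>2 * k = card V\<close>)
      then have "4 * num_edges V (crossing E A) \<le> 4 * (k * k)"
        using bipartite_num_edges_le[OF Suc.prems(1), of E A] by simp
      moreover have "k * card V = 2 * (k * k)" using \<open>2 * k = card V\<close> by (metis mult.left_commute)
      ultimately show False using Suc.prems(3) by linarith
    qed
    then have "2 * k \<le> card ?W" using Suc.prems(2) Suc.hyps(2) cW by linarith
    then obtain W where "W \<subseteq> ?W" "W \<noteq> {}" "\<forall>v\<in>W. k + 1 \<le> card {u \<in> W. crossing E A v u}"
      using Suc.hyps(1)[OF cW fW(1) _ e] by blast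
    then show ?thesis by blast
  qed
qed

end

theorem theorem1p7:
  fixes V :: "'a set" and E :: "'a \<Rightarrow> 'a \<Rightarrow> bool" and k n :: nat
  assumes "simple_graph V E"
    and "k \<ge> 1"
    and "card V = n"
    and "n \<ge> 2 * k + 2"
    and "real (num_edges V E) \<ge> 2 * real k * (real n - real k - 1 / 2)"
  shows "\<exists>m::nat. m \<ge> 2 \<and> (\<forall>i<k. has_cycle_of_length V E (2 * m + 2 * i))"
proof -
  interpret G: irreflexive_graph E
    using assms(1) unfolding simple_graph_def by unfold_locales blast+
  have fin: "finite V"
    using assms(1) unfolding simple_graph_def by blast
  have "real (2 * k * n) \<le> real (num_edges V E + 2 * k * k + k)"
    using assms(5) by (simp add: algebra_simps)
  then have e: "2 * k * card V \<le> num_edges V E + 2 * k * k + k"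
    using assms(3) of_nat_le_iff by blast
  have n: "2 * k + 2 \<le> card V" using assms(3,4) by simp
  obtain A where A: "num_edges V E + k + 1 \<le> 2 * num_edges V (crossing E A)"
    using G.dense_cut[OF fin assms(2) n e] by blast
  \<comment> \<open>The odd left side cannot equal the even right side, so the full
    \<open>+ 1\<close> survives the halving.\<close>
  have "2 * (k * card V) + 1 \<le> 2 * (num_edges V (crossing E A) + k * k)"
    using A e by (simp add: algebra_simps)
  moreover have "2 * x + 1 \<le> 2 * y \<Longrightarrow> x + 1 \<le> y" for x y :: nat by presburger
  ultimately have "k * card V + 1 \<le> num_edges V (crossing E A) + k * k" by blast
  then obtain W where W: "W \<subseteq> V" "W \<noteq> {}" "\<And>v. v \<in> W \<Longrightarrow> k + 1 \<le> card {u \<in> W. crossing E A v u}"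
    using G.min_degree_subgraph[OF fin assms(2), of A] n by (metis add_leD1)
  interpret bipartite_graph "crossing E A" "\<lambda>x. x \<in> A"
  proof
    show "crossing E A u v \<Longrightarrow> crossing E A v u" for u v using G.sym unfolding crossing_def by blast
    show "crossing E A u v \<Longrightarrow> (u \<in> A) \<noteq> (v \<in> A)" for u v unfolding crossing_def by blast
  qed
  have "finite W" using W(1) fin finite_subset by blast
  then obtain m where m: "2 \<le> m" "\<forall>i<k. has_cycle_of_length W (crossing E A) (2 * m + 2 * i)"
    using consecutive_even_cycles[OF _ W(2) assms(2) W(3)] by blast
  have "has_cycle_of_length W (crossing E A) l \<Longrightarrow> has_cycle_of_length V E l" for l
    using W(1) unfolding has_cycle_of_length_def crossing_def by blast
  then show ?thesis using m by blast
qed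

end
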